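(* Let $d \geq 2$ be an integer and let $E \subset M_d^{0}(\mathbb{Z})$ satisfy $\overline{d}(E) > 0$. Then there exists an integer $k \geq 1$ such that for every polynomial $f \in \mathbb{Z}[X]$ of the form \[ f(X) = X^d + k^2 a_{d-2} X^{d-2} + k^3 a_{d-3}X^{d-3} + \ldots + k^d a_0, \quad a_0,\ldots,a_{d-2} \in \mathbb{Z}, \] (i.e. the coefficient of $X^{d-j}$ is $k^j a_{d-j}$ for $2\le j\le d$, and the coefficient of $X^{d-1}$ is $0$), there exists a matrix $A \in E - E = \{x - y : x,y \in E\}$ whose characteristic polynomial $\det(X I - A)$ equals $f$.
   Context: $M_d^0(\mathbb{Z})$ denotes the additive group of $d\times d$ integer matrices with trace zero. For $n \ge 1$ let $F_n = \{A=(a_{ij}) \in M_d^0(\mathbb{Z}) : |a_{ij}| \le n \text{ for all } (i,j) \neq (d,d)\}$. For $E \subset M_d^0(\mathbb{Z})$, its upper asymptotic density is $\overline{d}(E) = \limsup_{n\to\infty} |E \cap F_n|/|F_n|$. *)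

theory Defs
  imports "Jordan_Normal_Form.Char_Poly" "HOL-Library.Extended_Real"
begin

definition M0 :: "nat \<Rightarrow> int mat set" where
  "M0 d = {A. A \<in> carrier_mat d d \<and> (\<Sum>i<d. A $$ (i, i)) = 0}"

definition Fbox :: "nat \<Rightarrow> nat \<Rightarrow> int mat set" where
  "Fbox d n = {A \<in> M0 d. \<forall>i<d. \<forall>j<d. (i, j) \<noteq> (d - 1, d - 1) \<longrightarrow> \<bar>A $$ (i, j)\<bar> \<le> int n}"

definition upper_density :: "nat \<Rightarrow> int mat set \<Rightarrow> ereal" where
  "upper_density d E = limsup (\<lambda>n. ereal (real (card (E \<inter> Fbox d (Suc n))) / real (card (Fbox d (Suc n)))))"

end

theory Submission
  imports
    "HOL-Analysis.Convex"
    "HOL-Analysis.Function_Topology"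
    "HOL-Analysis.Elementary_Normed_Spaces"
    "HOL-Library.Poly_Mapping"
    "HOL-Library.Function_Algebras"
    "HOL-Real_Asymp.Real_Asymp"
    Defs
begin

text \<open>
  Averaging over boxes along a suitable filter makes \<open>E\<close> define a positive semidefinite form on the real
  group ring of the trace zero matrices, invariant under translation, in which \<open>ip 1 (\<delta> v) > 0\<close> forces
  \<open>v \<in> E - E\<close>. Let \<open>energy q\<close> be the least squared norm of a convex combination of translates by multiples
  of \<open>q\<close>; it is bounded and increases under divisibility, so some \<open>k\<close> almost maximises it, and this is the
  required \<open>k\<close>. Given \<open>f\<close>, conjugate \<open>k\<close> times a companion matrix by the transvections \<open>1 + t N\<^sub>i\<close> with
  \<open>N\<^sub>i\<close> of rank one and square zero. Each family is a quadratic curve in \<open>t\<close> whose leading coefficient is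
  proportional to \<open>N\<^sub>i\<close>, and any sufficiently many of the \<open>N\<^sub>i\<close> span all trace zero matrices over the rationals.
  Averaging over \<open>t\<close> (van der Corput) and then over \<open>i\<close> kills everything that is orthogonal to the vectors
  invariant under a subgroup of finite index, and the choice of \<open>k\<close> leaves a positive main term.
\<close>

subsection \<open>Semi-inner products and the van der Corput inequality\<close>

text \<open>The form may be degenerate and its space incomplete, so neither orthogonal projections
  nor a spectral theorem are at hand. Their place is taken by a near minimiser \<open>\<mu>\<close>
  of the norm, standing for the projection of \<open>1\<close> onto the vectors invariant under a
  subgroup, and by \<open>1 - \<mu>\<close>, which long averages almost annihilate. The quantifiers
  force the detour through energy: \<open>k\<close> is fixed before \<open>f\<close> is known,
  whereas the finite index produced by the curves depends on \<open>f\<close>; almost maximal energy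
  at \<open>k\<close> survives passing to any further multiple \<open>k * m\<close>. Averaging over
  \<open>i\<close> is forced as well: van der Corput on one curve sees only its leading coefficient,
  hence a single direction, while \<open>1 - \<mu>\<close> becomes small only after averaging in
  enough directions at once. Powers of the averaged self-adjoint operator bridge the two, because
  most products of its summands involve distinct indices. Scaling a matrix by \<open>k\<close>
  multiplies the coefficient of \<open>X ^ (d - j)\<close> in its characteristic polynomial by
  \<open>k ^ j\<close>, which explains the shape of \<open>f\<close>.\<close>

locale semi_inner =
  fixes ip :: "'r::real_vector \<Rightarrow> 'r \<Rightarrow> real"
  assumes ip_add_left: "ip (a + b) c = ip a c + ip b c"
    and ip_scaleR_left: "ip (s *\<^sub>R a) c = s * ip a c"
    and ip_commute: "ip a b = ip b a"
    and ip_nonneg: "ip a a \<ge> 0"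
begin

definition nm :: "'r \<Rightarrow> real" where "nm a = sqrt (ip a a)"

lemma ip_add_right: "ip c (a + b) = ip c a + ip c b"
  by (metis ip_add_left ip_commute)

lemma ip_scaleR_right: "ip c (s *\<^sub>R a) = s * ip c a"
  by (metis ip_scaleR_left ip_commute)

lemma ip_zero_left [simp]: "ip 0 c = 0"
  using ip_scaleR_left[of 0 0 c] by simp

lemma ip_zero_right [simp]: "ip c 0 = 0"
  by (simp add: ip_commute[of c])

lemma ip_minus_left: "ip (- a) c = - ip a c"
  using ip_scaleR_left[of "-1" a c] by simp

lemma ip_minus_right: "ip c (- a) = - ip c a"
  by (metis ip_minus_left ip_commute)

lemma ip_diff_left: "ip (a - b) c = ip a c - ip b c"
  using ip_add_left[of a "- b" c] by (simp add: ip_minus_left)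

lemma ip_diff_right: "ip c (a - b) = ip c a - ip c b"
  by (metis ip_diff_left ip_commute)

lemma ip_sum_left: "ip (\<Sum>i\<in>I. f i) c = (\<Sum>i\<in>I. ip (f i) c)"
  by (induction I rule: infinite_finite_induct) (auto simp: ip_add_left)

lemma ip_sum_right: "ip c (\<Sum>i\<in>I. f i) = (\<Sum>i\<in>I. ip c (f i))"
  by (induction I rule: infinite_finite_induct) (auto simp: ip_add_right)

lemmas ip_linear = ip_add_left ip_add_right ip_scaleR_left ip_scaleR_right ip_diff_left ip_diff_right

lemma nm_nonneg [simp]: "nm a \<ge> 0"
  by (simp add: nm_def ip_nonneg)

lemma nm_square: "(nm a)\<^sup>2 = ip a a"
  by (simp add: nm_def ip_nonneg)

lemma ip_square_le: "(ip a b)\<^sup>2 \<le> ip a a * ip b b"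
proof (cases "ip b b = 0")
  case True
  have "ip a b = 0"
  proof (rule ccontr)
    assume ne: "ip a b \<noteq> 0"
    \<comment> \<open>For a null vector \<open>b\<close> the quadratic in \<open>t\<close> is
      affine, and this \<open>t\<close> gives it the value -1.\<close>
    define t where "t = - (ip a a + 1) / (2 * ip a b)"
    have "0 \<le> ip (a + t *\<^sub>R b) (a + t *\<^sub>R b)" by (rule ip_nonneg)
    also have "\<dots> = ip a a + 2 * t * ip a b"
      using True by (simp add: ip_linear ip_commute[of b a])
    also have "\<dots> = -1" using ne by (simp add: t_def field_simps)
    finally show False by simp
  qed
  then show ?thesis by (simp add: True)
next
  case False
  then have pos: "ip b b > 0" using ip_nonneg[of b] by simp
  define t where "t = - ip a b / ip b b"
  have "0 \<le> ip (a + t *\<^sub>R b) (a + t *\<^sub>R b)" by (rule ip_nonneg)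
  also have "\<dots> = ip a a + 2 * t * ip a b + t\<^sup>2 * ip b b"
    by (simp add: ip_linear ip_commute[of b a] power2_eq_square algebra_simps)
  also have "\<dots> = ip a a - (ip a b)\<^sup>2 / ip b b"
    using pos by (simp add: t_def field_simps power2_eq_square)
  finally show ?thesis using pos by (simp add: field_simps)
qed

lemma ip_abs_le: "\<bar>ip a b\<bar> \<le> nm a * nm b"
proof -
  have "\<bar>ip a b\<bar> = sqrt ((ip a b)\<^sup>2)" by simp
  also have "\<dots> \<le> sqrt (ip a a * ip b b)" by (rule real_sqrt_le_mono[OF ip_square_le])
  finally show ?thesis by (simp add: nm_def real_sqrt_mult)
qed

lemma nm_scaleR: "nm (s *\<^sub>R a) = \<bar>s\<bar> * nm a"
proof -
  have "ip (s *\<^sub>R a) (s *\<^sub>R a) = s\<^sup>2 * ip a a" by (simp add: ip_linear power2_eq_square)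
  then show ?thesis by (simp add: nm_def real_sqrt_mult)
qed

lemma nm_zero [simp]: "nm 0 = 0" by (simp add: nm_def)

lemma nm_minus [simp]: "nm (- a) = nm a"
  by (simp add: nm_def ip_minus_left ip_minus_right)

lemma nm_triangle: "nm (a + b) \<le> nm a + nm b"
proof (rule power2_le_imp_le)
  have "(nm (a + b))\<^sup>2 = (nm a)\<^sup>2 + 2 * ip a b + (nm b)\<^sup>2"
    by (simp add: nm_square ip_linear ip_commute[of b a])
  also have "\<dots> \<le> (nm a + nm b)\<^sup>2"
    using ip_abs_le[of a b] by (simp add: power2_sum)
  finally show "(nm (a + b))\<^sup>2 \<le> (nm a + nm b)\<^sup>2" .
qed simp

lemma nm_triangle_diff: "nm (a - b) \<le> nm a + nm b"
  using nm_triangle[of a "- b"] by simp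

lemma nm_sum: "nm (\<Sum>i\<in>I. f i) \<le> (\<Sum>i\<in>I. nm (f i))"
proof (induction I rule: infinite_finite_induct)
  case (insert x F)
  then show ?case using nm_triangle[of "f x" "sum f F"] by simp
qed auto

lemma nm_sum_bound:
  assumes "\<And>i. i \<in> I \<Longrightarrow> nm (f i) \<le> c"
  shows "nm (\<Sum>i\<in>I. f i) \<le> real (card I) * c"
  using nm_sum[of f I] sum_bounded_above[of I "\<lambda>i. nm (f i)" c] assms by force

lemma nm_average_square_le:
  assumes "n > 0"
  shows "(nm ((1 / real n) *\<^sub>R (\<Sum>i<n. f i)))\<^sup>2 \<le> (1 / real n) * (\<Sum>i<n. (nm (f i))\<^sup>2)"
proof -
  have "(nm (\<Sum>i<n. f i))\<^sup>2 \<le> (\<Sum>i<n. nm (f i))\<^sup>2"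
    by (intro power_mono nm_sum) simp
  also have "\<dots> \<le> (\<Sum>i<n. (nm (f i))\<^sup>2) * real n"
    using Cauchy_Schwarz_ineq_sum[of "\<lambda>i. nm (f i)" "\<lambda>_. 1" "{..<n}"] by simp
  finally show ?thesis
    using assms by (simp add: nm_scaleR power_mult_distrib field_simps power2_eq_square)
qed

text \<open>Replacing each \<open>v t\<close> by the mean of \<open>S\<close> consecutive terms
  changes the average only at its ends. Convexity of the square then reduces the claim to
  \<open>S * S\<close> correlations, of which the \<open>S\<close> diagonal ones contribute
  \<open>c\<^sup>2 / S\<close>. Only upper bounds on the correlations are used.\<close>

lemma van_der_Corput:
  assumes S: "S > 0" and T: "T > 0" and bd: "\<And>t. nm (v t) \<le> c"
    and corr: "\<And>s s'. s < S \<Longrightarrow> s' < S \<Longrightarrow> s \<noteq> s' \<Longrightarrow>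
        (1 / real T) * (\<Sum>t<T. ip (v (t + s)) (v (t + s'))) \<le> \<kappa>"
    and \<kappa>: "\<kappa> \<ge> 0"
  shows "(nm ((1 / real T) *\<^sub>R (\<Sum>t<T. v t)))\<^sup>2
    \<le> 2 * (2 * real S * c / real T)\<^sup>2 + 2 * (c\<^sup>2 / real S + \<kappa>)"
proof -
  have c: "c \<ge> 0" using bd[of 0] nm_nonneg[of "v 0"] by linarith
  define w where "w t = (1 / real S) *\<^sub>R (\<Sum>s<S. v (t + s))" for t
  define u where "u = (1 / real T) *\<^sub>R (\<Sum>t<T. v t)"
  define u' where "u' = (1 / real T) *\<^sub>R (\<Sum>t<T. w t)"
  \<comment> \<open>Sliding the window by one exchanges two terms, at a cost of at most
    \<open>2 * c\<close>.\<close>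
  have shift: "nm ((\<Sum>t<T. v t) - (\<Sum>t<T. v (t + s))) \<le> 2 * real s * c" for s
  proof (induction s)
    case (Suc s)
    have "(\<Sum>t<T. v (t + s)) + v (T + s) = (\<Sum>t<Suc T. v (t + s))" by simp
    also have "\<dots> = v s + (\<Sum>t<T. v (t + Suc s))"
      by (subst sum.lessThan_Suc_shift) simp
    finally have eq: "(\<Sum>t<T. v t) - (\<Sum>t<T. v (t + Suc s))
        = ((\<Sum>t<T. v t) - (\<Sum>t<T. v (t + s))) + (v s - v (T + s))"
      by (simp add: algebra_simps)
    show ?case unfolding eq
      using Suc nm_triangle[of "(\<Sum>t<T. v t) - (\<Sum>t<T. v (t + s))" "v s - v (T + s)"]
        nm_triangle_diff[of "v s" "v (T + s)"] bd[of s] bd[of "T + s"]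
      by (simp add: algebra_simps)
  qed simp
  have "u - u' = (1 / real T) *\<^sub>R (1 / real S) *\<^sub>R (\<Sum>s<S. (\<Sum>t<T. v t) - (\<Sum>t<T. v (t + s)))"
    using S unfolding u_def u'_def w_def scaleR_sum_right[symmetric] sum_subtractf
    by (subst sum.swap) (simp add: scaleR_diff_right sum_constant_scaleR)
  moreover have "nm (\<Sum>s<S. (\<Sum>t<T. v t) - (\<Sum>t<T. v (t + s))) \<le> real (card {..<S}) * (2 * real S * c)"
  proof (rule nm_sum_bound)
    fix s assume "s \<in> {..<S}"
    then have "2 * real s * c \<le> 2 * real S * c" using c by (simp add: mult_right_mono)
    then show "nm ((\<Sum>t<T. v t) - (\<Sum>t<T. v (t + s))) \<le> 2 * real S * c"
      using shift[of s] by linarith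
  qed
  ultimately have d: "nm (u - u') \<le> 2 * real S * c / real T"
    using S T by (simp add: nm_scaleR field_simps)
  have "(nm u')\<^sup>2 \<le> (1 / real T) * (\<Sum>t<T. (nm (w t))\<^sup>2)"
    unfolding u'_def by (rule nm_average_square_le[OF T])
  also have "\<dots> = (1 / (real S)\<^sup>2) * (\<Sum>s<S. \<Sum>s'<S. (1 / real T) * (\<Sum>t<T. ip (v (t + s)) (v (t + s'))))"
  proof -
    have "(\<Sum>t<T. (nm (w t))\<^sup>2)
      = (\<Sum>t<T. (1 / (real S)\<^sup>2) * (\<Sum>s<S. \<Sum>s'<S. ip (v (t + s)) (v (t + s'))))"
      by (rule sum.cong[OF refl], subst sum.swap)
        (simp add: nm_square w_def ip_scaleR_left ip_scaleR_right ip_sum_left ip_sum_right,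
          simp add: power2_eq_square sum_divide_distrib)
    also have "\<dots> = (1 / (real S)\<^sup>2) * (\<Sum>s<S. \<Sum>s'<S. \<Sum>t<T. ip (v (t + s)) (v (t + s')))"
      unfolding sum_distrib_left[symmetric]
      by (simp only: sum.swap[of _ _ "{..<T}"])
    finally show ?thesis by (simp add: sum_distrib_left mult.commute mult.left_commute)
  qed
  also have "\<dots> \<le> (1 / (real S)\<^sup>2) * (\<Sum>s<S. c\<^sup>2 + real S * \<kappa>)"
  proof (intro mult_left_mono sum_mono)
    fix s assume s: "s \<in> {..<S}"
    have diag: "(1 / real T) * (\<Sum>t<T. ip (v (t + s)) (v (t + s))) \<le> c\<^sup>2"
    proof -
      have "(\<Sum>t<T. ip (v (t + s)) (v (t + s))) \<le> (\<Sum>t<T. c\<^sup>2)"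
        unfolding nm_square[symmetric] by (intro sum_mono power_mono bd nm_nonneg)
      then show ?thesis using T by (simp add: field_simps)
    qed
    have "(\<Sum>s'<S. (1 / real T) * (\<Sum>t<T. ip (v (t + s)) (v (t + s'))))
        \<le> (\<Sum>s'<S. (if s' = s then c\<^sup>2 else 0) + \<kappa>)"
      using s diag corr[of s] \<kappa> by (intro sum_mono) (auto simp del: times_divide_eq_left intro: order_trans)
    also have "\<dots> = c\<^sup>2 + real S * \<kappa>" using s by (simp add: sum.distrib)
    finally show "(\<Sum>s'<S. (1 / real T) * (\<Sum>t<T. ip (v (t + s)) (v (t + s')))) \<le> c\<^sup>2 + real S * \<kappa>" .
  qed simp
  also have "\<dots> = c\<^sup>2 / real S + \<kappa>" using S by (simp add: field_simps power2_eq_square)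
  finally have u': "(nm u')\<^sup>2 \<le> c\<^sup>2 / real S + \<kappa>" .
  have "nm u \<le> nm (u - u') + nm u'" using nm_triangle[of "u - u'" u'] by simp
  then have "(nm u)\<^sup>2 \<le> (nm (u - u') + nm u')\<^sup>2" by (intro power_mono) auto
  also have "\<dots> \<le> 2 * (nm (u - u'))\<^sup>2 + 2 * (nm u')\<^sup>2"
    using sum_squares_bound[of "nm (u - u')" "nm u'"] by (simp add: power2_sum)
  also have "\<dots> \<le> 2 * (2 * real S * c / real T)\<^sup>2 + 2 * (c\<^sup>2 / real S + \<kappa>)"
    using d u' by (intro add_mono mult_left_mono power_mono) auto
  finally show ?thesis unfolding u_def .
qed

end

subsection \<open>Translation invariant forms on a group ring\<close>

text \<open>\<open>\<delta>\<close> embeds the group into its group ring, which acts on itself by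
  multiplication. The type of group elements is a ring so that integer multiples can be written
  \<open>of_int z * v\<close>. The bound \<open>c\<close> is where positive density enters.\<close>

locale shift_form = semi_inner ip
  for ip :: "'r::{comm_ring_1,real_algebra_1} \<Rightarrow> 'r \<Rightarrow> real" +
  fixes \<delta> :: "'a::comm_ring_1 \<Rightarrow> 'r" and G :: "'a set" and c :: real
  assumes \<delta>_0: "\<delta> 0 = 1" and \<delta>_add: "\<delta> (v + w) = \<delta> v * \<delta> w"
    and G_0: "0 \<in> G" and G_add: "v \<in> G \<Longrightarrow> w \<in> G \<Longrightarrow> v + w \<in> G"
    and G_minus: "v \<in> G \<Longrightarrow> - v \<in> G"
    and ip_shift: "v \<in> G \<Longrightarrow> ip (\<delta> v * a) (\<delta> v * b) = ip a b"
    and ip_one_le: "ip 1 1 \<le> 1"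
    and c_pos: "c > 0"
    and ip_lower: "a \<in> convex hull (\<delta> ` G) \<Longrightarrow> c \<le> ip a a"
begin

text \<open>Finitely supported probability measures on \<open>H\<close>; multiplication by them is
  averaging over translates.\<close>

abbreviation PM :: "'a set \<Rightarrow> 'r set" where "PM H \<equiv> convex hull (\<delta> ` H)"

definition multiples :: "int \<Rightarrow> 'a set" where "multiples q = (\<lambda>g. of_int q * g) ` G"

lemma G_of_nat: "v \<in> G \<Longrightarrow> of_nat n * v \<in> G"
  by (induction n) (auto simp: G_0 G_add distrib_right)

lemma G_of_int: "v \<in> G \<Longrightarrow> of_int z * v \<in> G"
  by (cases z rule: int_cases2) (use G_of_nat G_minus in auto)

lemma G_diff: "v \<in> G \<Longrightarrow> w \<in> G \<Longrightarrow> v - w \<in> G"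
  using G_add[OF _ G_minus, of v w] by simp

lemma G_sum: "(\<And>i. i \<in> I \<Longrightarrow> f i \<in> G) \<Longrightarrow> (\<Sum>i\<in>I. f i) \<in> G"
  by (induction I rule: infinite_finite_induct) (auto simp: G_0 G_add)

lemma nm_one_le: "nm 1 \<le> 1"
  using ip_one_le by (simp add: nm_def)

lemma nm_shift: "v \<in> G \<Longrightarrow> nm (\<delta> v * a) = nm a"
  by (simp add: nm_def ip_shift)

lemma \<delta>_minus_cancel: "\<delta> (- v) * (\<delta> v * a) = a"
  by (simp add: mult.assoc[symmetric] \<delta>_add[symmetric] \<delta>_0)

lemma ip_adjoint: "v \<in> G \<Longrightarrow> ip (\<delta> v * a) b = ip a (\<delta> (- v) * b)"
  using ip_shift[OF G_minus, of v "\<delta> v * a" b] by (simp add: \<delta>_minus_cancel)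

lemma PM_delta: "v \<in> H \<Longrightarrow> \<delta> v \<in> PM H"
  by (simp add: hull_inc)

lemma PM_one: "0 \<in> H \<Longrightarrow> 1 \<in> PM H"
  using PM_delta[of 0 H] by (simp add: \<delta>_0)

lemma PM_mono: "H \<subseteq> K \<Longrightarrow> a \<in> PM H \<Longrightarrow> a \<in> PM K"
  using hull_mono[of "\<delta> ` H" "\<delta> ` K" convex] by auto

lemma nm_PM:
  assumes "a \<in> PM G"
  shows "nm (a * y) \<le> nm y"
  using assms
proof (rule hull_induct)
  fix x assume "x \<in> \<delta> ` G"
  then show "nm (x * y) \<le> nm y" by (auto simp: nm_shift)
next
  show "convex {x. nm (x * y) \<le> nm y}"
  proof (rule convexI, goal_cases)
    case (1 a b u v)
    have "nm ((u *\<^sub>R a + v *\<^sub>R b) * y) = nm (u *\<^sub>R (a * y) + v *\<^sub>R (b * y))"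
      by (simp add: algebra_simps)
    also have "\<dots> \<le> u * nm (a * y) + v * nm (b * y)"
      using nm_triangle[of "u *\<^sub>R (a * y)" "v *\<^sub>R (b * y)"] 1 by (simp add: nm_scaleR)
    also have "\<dots> \<le> u * nm y + v * nm y"
      using 1 by (intro add_mono mult_left_mono) auto
    also have "\<dots> = nm y" using 1 by (simp add: distrib_right[symmetric])
    finally show ?case by simp
  qed
qed

lemma convex_preimage_mult: "convex C \<Longrightarrow> convex {a. a * b \<in> (C :: 'r set)}"
  unfolding convex_def by (auto simp: distrib_right)

lemma PM_mult:
  assumes H: "\<And>v w. v \<in> H \<Longrightarrow> w \<in> H \<Longrightarrow> v + w \<in> H" and a: "a \<in> PM H" and b: "b \<in> PM H"
  shows "a * b \<in> PM H"
proof -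
  have "\<delta> v * b \<in> PM H" if v: "v \<in> H" for v
  proof -
    have "b * \<delta> v \<in> PM H"
      using b
    proof (rule hull_induct)
      show "convex {x. x * \<delta> v \<in> PM H}" by (intro convex_preimage_mult convex_convex_hull)
    qed (auto simp: \<delta>_add[symmetric] intro!: PM_delta H v)
    then show ?thesis by (simp add: mult.commute)
  qed
  then show ?thesis
    using hull_induct[OF a, of "\<lambda>x. x * b \<in> PM H"]
    by (auto intro: convex_preimage_mult)
qed

lemma PM_average:
  assumes "n > 0" "\<And>i. i < n \<Longrightarrow> f i \<in> PM H"
  shows "(1 / real n) *\<^sub>R (\<Sum>i<n. f i) \<in> PM H"
  unfolding scaleR_sum_right using assms by (intro convex_sum) auto

lemma PM_prod:
  assumes "\<And>i. i \<in> I \<Longrightarrow> f i \<in> PM G"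
  shows "(\<Prod>i\<in>I. f i) \<in> PM G"
  using assms
  by (induction I rule: infinite_finite_induct) (auto intro!: PM_one PM_mult G_0 G_add)

lemma PM_power: "a \<in> PM G \<Longrightarrow> a ^ n \<in> PM G"
  using PM_prod[of "{..<n}" "\<lambda>_. a"] by simp

section \<open>Averages along arithmetic progressions\<close>

definition av :: "'a \<Rightarrow> int \<Rightarrow> nat \<Rightarrow> 'r" where
  "av w a n = (1 / real n) *\<^sub>R (\<Sum>j<n. \<delta> (of_int (a + int j) * w))"

text \<open>The window is symmetric about 0, which makes the operator self-adjoint.\<close>

definition gam :: "'a \<Rightarrow> nat \<Rightarrow> 'r" where
  "gam w H = av w (- int H) (2 * H + 1)"

lemma av_PM: "w \<in> G \<Longrightarrow> n > 0 \<Longrightarrow> av w a n \<in> PM G"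
  unfolding av_def by (intro PM_average PM_delta G_of_int) auto

lemma gam_PM: "w \<in> G \<Longrightarrow> gam w H \<in> PM G"
  unfolding gam_def by (intro av_PM) auto

lemma av_step:
  assumes w: "w \<in> G"
  shows "nm (av w a n * (1 - \<delta> w) * y) \<le> 2 / real n * nm y"
proof -
  have "(\<Sum>j<n. \<delta> (of_int (a + int j) * w)) * (1 - \<delta> w)
      = (\<Sum>j<n. \<delta> (of_int (a + int j) * w) - \<delta> (of_int (a + int (Suc j)) * w))"
    by (simp add: right_diff_distrib sum_distrib_left \<delta>_add[symmetric] sum_subtractf algebra_simps)
  also have "\<dots> = \<delta> (of_int a * w) - \<delta> (of_int (a + int n) * w)"
    by (subst sum_lessThan_telescope') simp
  finally have "av w a n * (1 - \<delta> w) * y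
      = (1 / real n) *\<^sub>R (\<delta> (of_int a * w) * y - \<delta> (of_int (a + int n) * w) * y)"
    by (simp add: av_def left_diff_distrib)
  moreover have "nm (\<delta> (of_int a * w) * y - \<delta> (of_int (a + int n) * w) * y) \<le> 2 * nm y"
    using nm_triangle_diff[of "\<delta> (of_int a * w) * y" "\<delta> (of_int (a + int n) * w) * y"]
    by (simp add: nm_shift[OF G_of_int[OF w]] del: of_int_add)
  ultimately show ?thesis by (simp add: nm_scaleR divide_right_mono)
qed

text \<open>A shift by \<open>w\<close> telescopes to the two ends of the window; a shift by
  \<open>z\<close> multiples of \<open>w\<close> is a chain of \<open>\<bar>z\<bar>\<close> such
  steps.\<close>

lemma av_shift:
  assumes w: "w \<in> G"
  shows "nm (av w a n * (1 - \<delta> (of_int z * w)) * y) \<le> 2 * \<bar>real_of_int z\<bar> / real n * nm y"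
proof -
  have nat: "nm (av w a n * (1 - \<delta> (of_nat m * w)) * y) \<le> 2 * real m / real n * nm y" for m y
  proof (induction m)
    case 0
    then show ?case by (simp add: \<delta>_0)
  next
    case (Suc m)
    have "av w a n * (1 - \<delta> (of_nat (Suc m) * w)) * y
      = av w a n * (1 - \<delta> (of_nat m * w)) * y + \<delta> (of_nat m * w) * (av w a n * (1 - \<delta> w) * y)"
      by (simp add: \<delta>_add algebra_simps)
    then have "nm (av w a n * (1 - \<delta> (of_nat (Suc m) * w)) * y)
      \<le> nm (av w a n * (1 - \<delta> (of_nat m * w)) * y) + nm (av w a n * (1 - \<delta> w) * y)"
      using nm_triangle[of "av w a n * (1 - \<delta> (of_nat m * w)) * y"] nm_shift[OF G_of_nat[OF w]] by metis
    also have "\<dots> \<le> 2 * real m / real n * nm y + 2 / real n * nm y"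
      by (intro add_mono Suc av_step w)
    also have "\<dots> = 2 * real (Suc m) / real n * nm y"
      by (simp add: add_divide_distrib algebra_simps)
    finally show ?case .
  qed
  show ?thesis
  proof (cases z rule: int_cases2)
    case (nonneg m)
    then show ?thesis using nat[of m y] by simp
  next
    case (nonpos m)
    have "\<delta> (of_nat m * w) * \<delta> (- (of_nat m * w)) = 1"
      by (simp add: \<delta>_add[symmetric] \<delta>_0)
    then have "av w a n * (1 - \<delta> (of_int z * w)) * y
        = - (\<delta> (- (of_nat m * w)) * (av w a n * (1 - \<delta> (of_nat m * w)) * y))"
      by (simp add: nonpos algebra_simps)
    then have "nm (av w a n * (1 - \<delta> (of_int z * w)) * y) = nm (av w a n * (1 - \<delta> (of_nat m * w)) * y)"
      by (simp add: nm_shift[OF G_minus[OF G_of_nat[OF w]]])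
    then show ?thesis using nat[of m y] nonpos by simp
  qed
qed

lemma gam_self_adjoint:
  assumes w: "w \<in> G"
  shows "ip (gam w H * a) b = ip a (gam w H * b)"
proof -
  let ?n = "2 * H + 1"
  have "(\<Sum>j<?n. ip (\<delta> (of_int (- int H + int j) * w) * a) b)
      = (\<Sum>j<?n. ip a (\<delta> (of_int (- int H + int (?n - Suc j)) * w) * b))"
  proof (rule sum.cong[OF refl])
    fix j assume "j \<in> {..<?n}"
    then have "- (- int H + int j) = - int H + int (?n - Suc j)" by auto
    then have "- (of_int (- int H + int j) * w) = of_int (- int H + int (?n - Suc j)) * w"
      by (metis mult_minus_left of_int_minus)
    then show "ip (\<delta> (of_int (- int H + int j) * w) * a) b
        = ip a (\<delta> (of_int (- int H + int (?n - Suc j)) * w) * b)"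
      using ip_adjoint[OF G_of_int[OF w]] by metis
  qed
  also have "\<dots> = (\<Sum>j<?n. ip a (\<delta> (of_int (- int H + int j) * w) * b))"
    by (rule sum.nat_diff_reindex)
  finally show ?thesis
    unfolding gam_def av_def
    by (simp add: ip_scaleR_left ip_scaleR_right sum_distrib_right ip_sum_left ip_sum_right
        del: sum.lessThan_Suc of_int_add of_int_minus of_nat_mult)
qed

text \<open>A long average along \<open>w\<close> hardly notices shifts by small multiples of
  \<open>w\<close>, so \<open>gam (of_int q * w) H\<close> can be inserted at small cost, after
  which the long average is dropped as a contraction. This trades a step \<open>w\<close> that
  varies with the lag for a common multiple of all of them.\<close>

lemma av_le_gam:
  assumes w: "w \<in> G" and T: "T > 0" and q: "\<bar>real_of_int q\<bar> \<le> Q"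
  shows "nm (av w a T * h) \<le> nm (gam (of_int q * w) H * h) + 2 * real H * Q / real T * nm h"
proof -
  let ?n = "2 * H + 1"
  let ?g = "\<lambda>j. \<delta> (of_int (- int H + int j) * (of_int q * w))"
  let ?\<gamma> = "gam (of_int q * w) H"
  have "(1 / real ?n) *\<^sub>R (\<Sum>j<?n. 1 - ?g j) = 1 - ?\<gamma>"
    by (simp add: gam_def av_def sum_subtractf scaleR_diff_right sum_constant_scaleR
        del: sum.lessThan_Suc of_int_add sum_constant)
  then have "av w a T * (1 - ?\<gamma>) * h = av w a T * ((1 / real ?n) *\<^sub>R (\<Sum>j<?n. 1 - ?g j)) * h"
    by (simp only:)
  also have "\<dots> = (1 / real ?n) *\<^sub>R (\<Sum>j<?n. av w a T * (1 - ?g j) * h)"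
    by (simp only: sum_distrib_left sum_distrib_right mult_scaleR_right mult_scaleR_left)
  finally have eq: "av w a T * (1 - ?\<gamma>) * h = (1 / real ?n) *\<^sub>R (\<Sum>j<?n. av w a T * (1 - ?g j) * h)" .
  have bd: "nm (\<Sum>j<?n. av w a T * (1 - ?g j) * h)
      \<le> real (card {..<?n}) * (2 * real H * Q / real T * nm h)"
  proof (rule nm_sum_bound)
    fix j assume j: "j \<in> {..<?n}"
    have "\<bar>real_of_int ((- int H + int j) * q)\<bar> \<le> real H * Q"
      using j q by (auto simp: abs_mult intro!: mult_mono)
    then have "2 * \<bar>real_of_int ((- int H + int j) * q)\<bar> / real T * nm h \<le> 2 * real H * Q / real T * nm h"
      by (intro mult_right_mono divide_right_mono) auto
    moreover have "?g j = \<delta> (of_int ((- int H + int j) * q) * w)" by (simp add: mult.assoc)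
    ultimately show "nm (av w a T * (1 - ?g j) * h) \<le> 2 * real H * Q / real T * nm h"
      using av_shift[OF w, of a T "(- int H + int j) * q" h] by simp
  qed
  have "nm (av w a T * (1 - ?\<gamma>) * h) = \<bar>1 / real ?n\<bar> * nm (\<Sum>j<?n. av w a T * (1 - ?g j) * h)"
    by (simp only: eq nm_scaleR)
  also have "\<dots> \<le> \<bar>1 / real ?n\<bar> * (real (card {..<?n}) * (2 * real H * Q / real T * nm h))"
    by (intro mult_left_mono bd) auto
  also have "\<dots> = 2 * real H * Q / real T * nm h" by simp
  finally have *: "nm (av w a T * (1 - ?\<gamma>) * h) \<le> 2 * real H * Q / real T * nm h" .
  have "av w a T * h = av w a T * (?\<gamma> * h) + av w a T * (1 - ?\<gamma>) * h"
    by (simp add: algebra_simps)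
  then have "nm (av w a T * h) \<le> nm (av w a T * (?\<gamma> * h)) + nm (av w a T * (1 - ?\<gamma>) * h)"
    using nm_triangle by metis
  also have "\<dots> \<le> nm (?\<gamma> * h) + 2 * real H * Q / real T * nm h"
    using * nm_PM[OF av_PM[OF w T]] by (intro add_mono) auto
  finally show ?thesis .
qed

text \<open>Differencing a quadratic curve leaves an arithmetic progression whose step is
  \<open>2 * (s - s') * k\<close> times \<open>C\<close>. All these steps divide
  \<open>2 * fact S * k\<close> times \<open>C\<close>, so a single averaging operator bounds every
  correlation.\<close>

lemma curve_average_bound:
  fixes k :: int
  assumes A: "A \<in> G" and B: "B \<in> G" and C: "C \<in> G" and S: "S > 0" and T: "T > 0" and h: "nm h \<le> b"
  shows "(nm ((1 / real T) *\<^sub>R (\<Sum>t<T. \<delta> (of_int k * (A + of_nat t * B + (of_nat t)\<^sup>2 * C))) * h))\<^sup>2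
     \<le> 2 * (2 * real S * b / real T)\<^sup>2 + 2 * (b\<^sup>2 / real S
        + b * (nm (gam (of_int (2 * fact S * k) * C) H * h) + 2 * real H * fact S / real T * b))"
    (is "_ \<le> 2 * _ + 2 * (_ + ?\<kappa>)")
proof -
  define P where "P t = of_int k * (A + of_nat t * B + (of_nat t)\<^sup>2 * C)" for t :: nat
  have G2: "(of_nat n)\<^sup>2 * v \<in> G" if "v \<in> G" for v and n :: nat
    using G_of_nat[OF G_of_nat[OF that]] by (simp add: power2_eq_square mult.assoc)
  have P: "P t \<in> G" for t
    unfolding P_def by (intro G_of_int G_add G_of_nat G2 A B C)
  have b: "b \<ge> 0" using h nm_nonneg[of h] by linarith
  have \<kappa>: "?\<kappa> \<ge> 0" using b by (intro mult_nonneg_nonneg add_nonneg_nonneg) auto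
  have "(nm ((1 / real T) *\<^sub>R (\<Sum>t<T. \<delta> (P t) * h)))\<^sup>2
      \<le> 2 * (2 * real S * b / real T)\<^sup>2 + 2 * (b\<^sup>2 / real S + ?\<kappa>)"
  proof (rule van_der_Corput[OF S T _ _ \<kappa>])
    show "nm (\<delta> (P t) * h) \<le> b" for t using h by (simp add: nm_shift P)
  next
    fix s s' assume ss: "s < S" "s' < S" "s \<noteq> s'"
    define r where "r = int s - int s'"
    define w where "w = of_int (2 * r * k) * C"
    define X where "X = P s - P s'"
    have w: "w \<in> G" unfolding w_def by (intro G_of_int C)
    have X: "X \<in> G" unfolding X_def by (intro G_diff P)
    \<comment> \<open>The coefficients \<open>A\<close> and \<open>B\<close> disappear into the
      constant \<open>X\<close>; the dependence on \<open>t\<close> involves \<open>C\<close>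
      alone.\<close>
    have diff: "P (t + s) - P (t + s') = X + of_int (0 + int t) * w" for t
      by (simp add: P_def X_def w_def r_def algebra_simps power2_eq_square)
    \<comment> \<open>The lag is nonzero and smaller than \<open>S\<close> in absolute
      value.\<close>
    have "r dvd fact S"
    proof -
      have "nat \<bar>r\<bar> dvd fact S" using ss by (intro dvd_fact) (auto simp: r_def)
      then have "int (nat \<bar>r\<bar>) dvd int (fact S)" by (simp only: int_dvd_int_iff)
      then show ?thesis by simp
    qed
    then obtain q where q: "fact S = r * q" by (elim dvdE)
    have "r \<noteq> 0" using ss by (simp add: r_def)
    have qle: "\<bar>real_of_int q\<bar> \<le> fact S"
    proof -
      have "\<bar>q\<bar> * 1 \<le> \<bar>q\<bar> * \<bar>r\<bar>" using \<open>r \<noteq> 0\<close> by (intro mult_left_mono) auto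
      also have "\<dots> = \<bar>fact S\<bar>" by (simp add: q abs_mult mult.commute)
      finally have "\<bar>q\<bar> \<le> fact S" by simp
      then have "real_of_int \<bar>q\<bar> \<le> real_of_int (fact S)" by (simp only: of_int_le_iff)
      then show ?thesis by simp
    qed
    have "ip (\<delta> (P (t + s)) * h) (\<delta> (P (t + s')) * h) = ip (\<delta> X * \<delta> (of_int (0 + int t) * w) * h) h" for t
    proof -
      have "ip (\<delta> (P (t + s)) * h) (\<delta> (P (t + s')) * h)
          = ip (\<delta> (P (t + s')) * (\<delta> (P (t + s) - P (t + s')) * h)) (\<delta> (P (t + s')) * h)"
        by (simp add: mult.assoc[symmetric] \<delta>_add[symmetric])
      also have "\<dots> = ip (\<delta> (P (t + s) - P (t + s')) * h) h" by (rule ip_shift[OF P])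
      finally show ?thesis unfolding diff by (simp add: \<delta>_add mult.assoc)
    qed
    then have "(1 / real T) * (\<Sum>t<T. ip (\<delta> (P (t + s)) * h) (\<delta> (P (t + s')) * h))
        = ip (\<delta> X * (av w 0 T * h)) h"
      by (simp add: av_def ip_scaleR_left sum_distrib_right sum_distrib_left ip_sum_left mult.assoc)
    also have "\<dots> \<le> nm (\<delta> X * (av w 0 T * h)) * nm h"
      using ip_abs_le[of "\<delta> X * (av w 0 T * h)" h] by linarith
    also have "\<dots> = nm (av w 0 T * h) * nm h" by (simp add: nm_shift X)
    also have "\<dots> \<le> (nm (gam (of_int q * w) H * h) + 2 * real H * fact S / real T * b) * b"
    proof (intro mult_mono h nm_nonneg)
      have "nm (av w 0 T * h) \<le> nm (gam (of_int q * w) H * h) + 2 * real H * fact S / real T * nm h"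
        by (rule av_le_gam[OF w T qle])
      also have "\<dots> \<le> nm (gam (of_int q * w) H * h) + 2 * real H * fact S / real T * b"
        by (intro add_left_mono mult_left_mono h) auto
      finally show "nm (av w 0 T * h) \<le> \<dots>" .
    qed (use b in auto)
    also have "of_int q * w = of_int (2 * fact S * k) * C"
      unfolding q w_def by (simp add: ac_simps)
    finally show "(1 / real T) * (\<Sum>t<T. ip (\<delta> (P (t + s)) * h) (\<delta> (P (t + s')) * h)) \<le> ?\<kappa>"
      by (simp add: mult.commute)
  qed
  then show ?thesis by (simp add: P_def sum_distrib_right)
qed

section \<open>Powers of averages of self-adjoint operators\<close>

lemma self_adjoint_power:
  assumes "\<And>a b. ip (B * a) b = ip a (B * b)"
  shows "ip (B ^ n * a) b = ip a (B ^ n * b)"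
proof (induction n arbitrary: a b)
  case (Suc n)
  have "ip (B ^ Suc n * a) b = ip a (B ^ n * (B * b))" by (simp add: mult.assoc assms Suc)
  then show ?case by (simp add: mult.left_commute mult.assoc)
qed simp

text \<open>Log-convexity of \<open>n \<mapsto> nm (B ^ n * h)\<close> for self-adjoint \<open>B\<close>, along powers of two.\<close>

lemma self_adjoint_power_bound:
  assumes sa: "\<And>a b. ip (B * a) b = ip a (B * b)" and h: "nm h \<le> b" and b: "b > 0"
  shows "(nm (B * h) / b) ^ (2 ^ r) \<le> nm (B ^ (2 ^ r) * h) / b"
proof (induction r)
  case (Suc r)
  let ?n = "2 ^ r :: nat"
  have "(nm (B ^ ?n * h))\<^sup>2 = ip h (B ^ (2 ^ Suc r) * h)"
    by (simp add: nm_square self_adjoint_power[OF sa] mult.assoc[symmetric] power_add[symmetric] mult_2)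
  also have "\<dots> \<le> nm h * nm (B ^ (2 ^ Suc r) * h)" using ip_abs_le by (meson abs_le_D1)
  also have "\<dots> \<le> b * nm (B ^ (2 ^ Suc r) * h)" by (intro mult_right_mono h) simp
  finally have *: "(nm (B ^ ?n * h))\<^sup>2 \<le> b * nm (B ^ (2 ^ Suc r) * h)" .
  have "(nm (B * h) / b) ^ (2 ^ Suc r) = ((nm (B * h) / b) ^ ?n)\<^sup>2"
    by (simp add: power_mult[symmetric] mult.commute)
  also have "\<dots> \<le> (nm (B ^ ?n * h) / b)\<^sup>2"
    using b by (intro power_mono Suc) auto
  also have "\<dots> \<le> nm (B ^ (2 ^ Suc r) * h) / b"
    using * b by (simp add: power_divide field_simps power2_eq_square)
  finally show ?case .
qed simp

text \<open>Factors of \<open>B\<close> are expanded one at a time. A fresh index enlarges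
  \<open>I\<close> and is handled by induction; an index already in \<open>I\<close> arises for at
  most \<open>R\<close> of the \<open>L\<close> choices and is bounded trivially by
  \<open>b\<close>. Once \<open>R\<close> distinct indices are collected, \<open>small\<close>
  applies.\<close>

lemma average_power_bound:
  assumes L: "L > 0" and \<beta>: "\<And>i. i < L \<Longrightarrow> \<beta> i \<in> PM G" and h: "nm h \<le> b"
    and small: "\<And>I. I \<subseteq> {..<L} \<Longrightarrow> card I = R \<Longrightarrow> nm ((\<Prod>i\<in>I. \<beta> i) * h) \<le> \<eta>"
    and B: "B = (1 / real L) *\<^sub>R (\<Sum>i<L. \<beta> i)" and \<eta>: "\<eta> \<ge> 0"
  shows "I \<subseteq> {..<L} \<Longrightarrow> card I + n = R \<Longrightarrow>
    nm ((\<Prod>i\<in>I. \<beta> i) * (B ^ n * h)) \<le> real n * (real R * b / real L) + \<eta>"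
proof (induction n arbitrary: I)
  case 0
  then show ?case using small[of I] by simp
next
  case (Suc n)
  have fin: "finite I" using Suc.prems finite_subset by blast
  have b: "b \<ge> 0" using h nm_nonneg[of h] by linarith
  have BPM: "B \<in> PM G" unfolding B by (intro PM_average L \<beta>)
  let ?K = "real n * (real R * b / real L) + \<eta>"
  have K: "?K \<ge> 0" using b \<eta> by simp
  have "(\<Prod>i\<in>I. \<beta> i) * (B ^ Suc n * h) = (1 / real L) *\<^sub>R (\<Sum>i<L. ((\<Prod>i\<in>I. \<beta> i) * \<beta> i) * (B ^ n * h))"
    by (simp add: B[symmetric] sum_distrib_left[symmetric] sum_distrib_right[symmetric] mult.assoc)
      (simp add: B mult.assoc[symmetric])
  moreover have "nm (\<Sum>i<L. ((\<Prod>i\<in>I. \<beta> i) * \<beta> i) * (B ^ n * h)) \<le> (\<Sum>i<L. (if i \<in> I then b else 0) + ?K)"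
  proof (rule order_trans[OF nm_sum], rule sum_mono)
    fix i assume i: "i \<in> {..<L}"
    show "nm (((\<Prod>i\<in>I. \<beta> i) * \<beta> i) * (B ^ n * h)) \<le> (if i \<in> I then b else 0) + ?K"
    proof (cases "i \<in> I")
      case True
      have "(\<Prod>i\<in>I. \<beta> i) * \<beta> i * B ^ n \<in> PM G"
        using Suc.prems i by (intro PM_mult G_add PM_prod PM_power BPM \<beta>) auto
      from nm_PM[OF this, of h] show ?thesis using True h K by (simp add: mult.assoc)
    next
      case False
      have "nm ((\<Prod>i\<in>insert i I. \<beta> i) * (B ^ n * h)) \<le> ?K"
        using Suc.prems i False fin by (intro Suc.IH) auto
      then show ?thesis using False fin by (simp add: mult.commute)
    qed
  qed
  moreover have "(\<Sum>i<L. (if i \<in> I then b else 0) + ?K) = real (card I) * b + real L * ?K"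
    using Suc.prems by (simp add: sum.distrib sum.If_cases Int_absorb1)
  moreover have "real (card I) * b \<le> real R * b"
    using Suc.prems b by (intro mult_right_mono) auto
  ultimately have "nm ((\<Prod>i\<in>I. \<beta> i) * (B ^ Suc n * h)) \<le> (1 / real L) * (real R * b + real L * ?K)"
    using L by (simp add: nm_scaleR divide_right_mono)
  also have "\<dots> = real (Suc n) * (real R * b / real L) + \<eta>"
    using L by (simp add: field_simps)
  finally show ?case .
qed

text \<open>Each \<open>gam (w i) H\<close> nearly absorbs a fixed multiple of \<open>w i\<close>,
  and an element of \<open>K\<close> is a sum of such multiples. \<open>D\<close> may depend on
  \<open>a\<close> but not on \<open>H\<close>, so the product tends to annihilate
  \<open>1 - a\<close> as \<open>H\<close> grows.\<close>

lemma almost_invariant_product: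
  assumes fin: "finite I" and w: "\<And>i. i \<in> I \<Longrightarrow> w i \<in> G" and a: "a \<in> PM K"
    and K: "\<And>g. g \<in> K \<Longrightarrow> \<exists>z. g = (\<Sum>i\<in>I. of_int (z i) * w i)"
  shows "\<exists>D. \<forall>H. nm ((\<Prod>i\<in>I. (gam (w i) H)\<^sup>2) * (1 - a)) \<le> D / real (2 * H + 1)"
  using a
proof (rule hull_induct)
  fix x assume "x \<in> \<delta> ` K"
  then obtain z where x: "x = \<delta> (\<Sum>i\<in>I. of_int (z i) * w i)" using K by blast
  have "nm ((\<Prod>i\<in>I. (gam (w i) H)\<^sup>2) * (1 - \<delta> (\<Sum>i\<in>J. of_int (z i) * w i)))
      \<le> (\<Sum>i\<in>J. 2 * \<bar>real_of_int (z i)\<bar>) / real (2 * H + 1)" if "J \<subseteq> I" for H J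
    using finite_subset[OF that fin] that
  proof (induction J rule: finite_induct)
    case empty
    then show ?case by (simp add: \<delta>_0)
  next
    case (insert j J)
    let ?\<Pi> = "\<Prod>i\<in>I. (gam (w i) H)\<^sup>2"
    let ?u = "\<delta> (\<Sum>i\<in>J. of_int (z i) * w i)" and ?v = "\<delta> (of_int (z j) * w j)"
    \<comment> \<open>One copy of \<open>gam (w j) H\<close> absorbs the shift; all remaining
      factors only contract.\<close>
    let ?rest = "gam (w j) H * (\<Prod>i\<in>I - {j}. (gam (w i) H)\<^sup>2)"
    have j: "j \<in> I" using insert by simp
    have rest: "?rest \<in> PM G" using w j by (intro PM_mult G_add PM_prod PM_power gam_PM) auto
    have \<Pi>: "?\<Pi> = ?rest * gam (w j) H"
      using fin j by (subst prod.remove[of I j]) (auto simp: power2_eq_square mult_ac)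
    have "?\<Pi> * (1 - ?v) = ?rest * (av (w j) (- int H) (2 * H + 1) * (1 - ?v) * 1)"
      unfolding \<Pi> gam_def[symmetric] by (simp only: mult.assoc mult_1_right)
    then have "nm (?\<Pi> * (1 - ?v)) \<le> nm (av (w j) (- int H) (2 * H + 1) * (1 - ?v) * 1)"
      using nm_PM[OF rest] by metis
    also have "\<dots> \<le> 2 * \<bar>real_of_int (z j)\<bar> / real (2 * H + 1) * nm 1"
      by (rule av_shift) (use w j in auto)
    also have "\<dots> \<le> 2 * \<bar>real_of_int (z j)\<bar> / real (2 * H + 1) * 1"
      by (intro mult_left_mono nm_one_le) auto
    finally have v: "nm (?\<Pi> * (1 - ?v)) \<le> 2 * \<bar>real_of_int (z j)\<bar> / real (2 * H + 1)" by simp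
    have wJ: "(\<Sum>i\<in>J. of_int (z i) * w i) \<in> G" using insert w by (intro G_sum G_of_int) auto
    have "?\<Pi> * (1 - \<delta> (\<Sum>i\<in>insert j J. of_int (z i) * w i))
        = ?\<Pi> * (1 - ?u) + ?u * (?\<Pi> * (1 - ?v))"
      using insert by (simp add: \<delta>_add algebra_simps)
    then have "nm (?\<Pi> * (1 - \<delta> (\<Sum>i\<in>insert j J. of_int (z i) * w i)))
        \<le> nm (?\<Pi> * (1 - ?u)) + nm (?\<Pi> * (1 - ?v))"
      using nm_triangle[of "?\<Pi> * (1 - ?u)" "?u * (?\<Pi> * (1 - ?v))"] by (simp add: nm_shift wJ)
    also have "\<dots> \<le> (\<Sum>i\<in>J. 2 * \<bar>real_of_int (z i)\<bar>) / real (2 * H + 1)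
        + 2 * \<bar>real_of_int (z j)\<bar> / real (2 * H + 1)"
      using insert by (intro add_mono v) auto
    also have "\<dots> = (\<Sum>i\<in>insert j J. 2 * \<bar>real_of_int (z i)\<bar>) / real (2 * H + 1)"
      using insert by (simp add: add_divide_distrib)
    finally show ?case .
  qed
  from this[of I] show "\<exists>D. \<forall>H. nm ((\<Prod>i\<in>I. (gam (w i) H)\<^sup>2) * (1 - x)) \<le> D / real (2 * H + 1)"
    unfolding x by blast
next
  show "convex {x. \<exists>D. \<forall>H. nm ((\<Prod>i\<in>I. (gam (w i) H)\<^sup>2) * (1 - x)) \<le> D / real (2 * H + 1)}"
  proof (rule convexI, goal_cases)
    case (1 x y s t)
    then obtain D D' where
      D: "\<And>H. nm ((\<Prod>i\<in>I. (gam (w i) H)\<^sup>2) * (1 - x)) \<le> D / real (2 * H + 1)"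
         "\<And>H. nm ((\<Prod>i\<in>I. (gam (w i) H)\<^sup>2) * (1 - y)) \<le> D' / real (2 * H + 1)" by auto
    have "nm ((\<Prod>i\<in>I. (gam (w i) H)\<^sup>2) * (1 - (s *\<^sub>R x + t *\<^sub>R y))) \<le> (s * D + t * D') / real (2 * H + 1)" for H
    proof -
      let ?\<Pi> = "\<Prod>i\<in>I. (gam (w i) H)\<^sup>2"
      have "1 - (s *\<^sub>R x + t *\<^sub>R y) = s *\<^sub>R (1 - x) + t *\<^sub>R (1 - y)"
        using 1 scaleR_add_left[of s t "1::'r"] by (simp add: algebra_simps)
      then have "nm (?\<Pi> * (1 - (s *\<^sub>R x + t *\<^sub>R y))) = nm (s *\<^sub>R (?\<Pi> * (1 - x)) + t *\<^sub>R (?\<Pi> * (1 - y)))"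
        by (simp add: distrib_left)
      also have "\<dots> \<le> s * nm (?\<Pi> * (1 - x)) + t * nm (?\<Pi> * (1 - y))"
        using nm_triangle[of "s *\<^sub>R (?\<Pi> * (1 - x))" "t *\<^sub>R (?\<Pi> * (1 - y))"] 1 by (simp add: nm_scaleR)
      also have "\<dots> \<le> s * (D / real (2 * H + 1)) + t * (D' / real (2 * H + 1))"
        using 1 D by (intro add_mono mult_left_mono) auto
      finally show ?thesis by (simp add: add_divide_distrib)
    qed
    then show ?case by blast
  qed
qed

text \<open>Individual factors need not be small on \<open>h\<close>, only products of
  \<open>2 ^ r\<close> distinct ones. Using squares makes \<open>ip (B * h) h\<close> the mean of
  \<open>(nm (gam (w i) H * h))\<^sup>2\<close>. The power \<open>B ^ (2 ^ r)\<close> is small on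
  \<open>h\<close> because repeated indices are rare, and log-convexity carries this back to
  \<open>B\<close> itself.\<close>

lemma average_gam_small:
  assumes h: "nm h \<le> 2" and \<epsilon>: "\<epsilon> > 0" and w: "\<And>i. w i \<in> G" and L: "L > 0"
    and L_large: "real ((2 ^ r)\<^sup>2) / real L \<le> (\<epsilon>\<^sup>2 / 4) ^ (2 ^ r) / 2"
    and small: "\<And>I. I \<subseteq> {..<L} \<Longrightarrow> card I = 2 ^ r \<Longrightarrow>
      nm ((\<Prod>i\<in>I. (gam (w i) H)\<^sup>2) * h) \<le> (\<epsilon>\<^sup>2 / 4) ^ (2 ^ r)"
  shows "(1 / real L) * (\<Sum>i<L. nm (gam (w i) H * h)) \<le> \<epsilon>"
proof -
  define R :: nat where "R = 2 ^ r"
  define \<beta> where "\<beta> i = (gam (w i) H)\<^sup>2" for i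
  define B where "B = (1 / real L) *\<^sub>R (\<Sum>i<L. \<beta> i)"
  \<comment> \<open>Chosen so that \<open>nm (B * h) \<le> 2 * \<rho>\<close> and
    \<open>nm h \<le> 2\<close> give exactly \<open>\<epsilon>\<^sup>2\<close>.\<close>
  define \<rho> where "\<rho> = \<epsilon>\<^sup>2 / 4"
  have \<rho>: "\<rho> > 0" using \<epsilon> by (simp add: \<rho>_def)
  have \<beta>PM: "\<beta> i \<in> PM G" for i unfolding \<beta>_def by (intro PM_power gam_PM w)
  have \<beta>sa: "ip (\<beta> i * a) b = ip (gam (w i) H * a) (gam (w i) H * b)" for i a b
    by (simp add: \<beta>_def power2_eq_square mult.assoc gam_self_adjoint[OF w])
  have sa: "ip (B * a) b = ip a (B * b)" for a b
    using \<beta>sa \<beta>sa[of _ b a]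
    by (simp add: B_def ip_scaleR_left ip_scaleR_right sum_distrib_right ip_sum_left ip_sum_right
        ip_commute[of a] ip_commute[of "gam _ _ * b"])
  have "nm ((\<Prod>i\<in>{}. \<beta> i) * (B ^ R * h)) \<le> real R * (real R * 2 / real L) + \<rho> ^ R"
  proof (rule average_power_bound[OF L _ h])
    show "nm ((\<Prod>i\<in>I. \<beta> i) * h) \<le> \<rho> ^ R" if "I \<subseteq> {..<L}" "card I = R" for I
      using small that unfolding \<beta>_def R_def \<rho>_def by blast
  qed (use \<beta>PM B_def \<rho> in auto)
  then have "nm (B ^ R * h) / 2 \<le> real (R\<^sup>2) / real L + \<rho> ^ R / 2"
    by (simp add: power2_eq_square field_simps)
  also have "\<dots> \<le> \<rho> ^ R" using L_large unfolding R_def \<rho>_def by linarith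
  finally have "(nm (B * h) / 2) ^ R \<le> \<rho> ^ R"
    using self_adjoint_power_bound[OF sa h, of r] unfolding R_def by simp
  then have B\<rho>: "nm (B * h) / 2 \<le> \<rho>"
    using \<rho> by (subst (asm) power_mono_iff) (auto simp: R_def)
  have "((1 / real L) * (\<Sum>i<L. nm (gam (w i) H * h)))\<^sup>2 \<le> (1 / real L) * (\<Sum>i<L. (nm (gam (w i) H * h))\<^sup>2)"
  proof -
    have "(\<Sum>i<L. nm (gam (w i) H * h))\<^sup>2 \<le> (\<Sum>i<L. (nm (gam (w i) H * h))\<^sup>2) * real L"
      using Cauchy_Schwarz_ineq_sum[of "\<lambda>i. nm (gam (w i) H * h)" "\<lambda>_. 1" "{..<L}"] by simp
    then show ?thesis using L by (simp add: power_divide field_simps power2_eq_square)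
  qed
  also have "\<dots> = ip (B * h) h"
    using \<beta>sa by (simp add: B_def nm_square ip_scaleR_left sum_distrib_right ip_sum_left)
  also have "\<dots> \<le> nm (B * h) * nm h" using ip_abs_le by (meson abs_le_D1)
  also have "\<dots> \<le> (2 * \<rho>) * 2" using B\<rho> h \<rho> by (intro mult_mono) auto
  also have "\<dots> = \<epsilon>\<^sup>2" by (simp add: \<rho>_def)
  finally show ?thesis by (rule power2_le_imp_le) (use \<epsilon> in simp)
qed

text \<open>An exact minimiser \<open>w\<close> satisfies
  \<open>ip x w \<ge> ip w w \<ge> c\<close>, as seen by moving from \<open>w\<close> towards
  \<open>x\<close>. For a near minimiser the move must have positive length, and half of the bound
  remains.\<close>

lemma near_minimiser_ip_lower:
  assumes x: "x \<in> PM H" "ip x x \<le> 1" and w: "w \<in> PM H"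
    and e: "\<And>a. a \<in> PM H \<Longrightarrow> e \<le> ip a a" and e0: "c \<le> e" "e \<le> 1"
    and near: "ip w w \<le> e + c\<^sup>2 / 16"
  shows "c / 2 \<le> ip x w"
proof -
  \<comment> \<open>With this length of the move, the slack allowed in \<open>near\<close> is
    \<open>s\<^sup>2\<close>, of the same order as the quadratic term.\<close>
  define s where "s = c / 4"
  have s: "0 < s" "s \<le> 1/4" using c_pos e0 by (auto simp: s_def)
  have s2: "s\<^sup>2 = c\<^sup>2 / 16" by (simp add: s_def power_divide)
  have "e \<le> ip ((1 - s) *\<^sub>R w + s *\<^sub>R x) ((1 - s) *\<^sub>R w + s *\<^sub>R x)"
    using s by (intro e convexD[OF convex_convex_hull] w x) auto
  also have "\<dots> = (1 - s)\<^sup>2 * ip w w + 2 * s * (1 - s) * ip x w + s\<^sup>2 * ip x x"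
    by (simp add: ip_linear ip_commute[of w x] power2_eq_square algebra_simps)
  also have "\<dots> \<le> (1 - s)\<^sup>2 * (e + c\<^sup>2 / 16) + 2 * s * (1 - s) * ip x w + s\<^sup>2 * 1"
    using near x by (intro add_mono mult_left_mono order_refl) auto
  finally have 1: "e \<le> (1 - s)\<^sup>2 * (e + c\<^sup>2 / 16) + 2 * s * (1 - s) * ip x w + s\<^sup>2" by simp
  have "(1 - s)\<^sup>2 * (c\<^sup>2 / 16) \<le> 1 * (c\<^sup>2 / 16)"
    using s by (intro mult_right_mono power_le_one) auto
  then have "(1 - s)\<^sup>2 * (e + c\<^sup>2 / 16) \<le> (1 - s)\<^sup>2 * e + s\<^sup>2"
    unfolding distrib_left s2 by linarith
  moreover have "s * s * e \<le> s * s * 1" using e0 s by (intro mult_left_mono) auto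
  ultimately have "e \<le> (1 - s)\<^sup>2 * e + s\<^sup>2 + 2 * s * (1 - s) * ip x w + s\<^sup>2" "s\<^sup>2 * e \<le> s\<^sup>2"
    using 1 by (auto simp: power2_eq_square)
  moreover have "(1 - s)\<^sup>2 * e = e - 2 * s * e + s\<^sup>2 * e"
    by (simp add: power2_eq_square algebra_simps)
  ultimately have "2 * s * e - 3 * s\<^sup>2 \<le> 2 * s * (1 - s) * ip x w" by linarith
  then have "s * (2 * e - 3 * s) \<le> s * (2 * (1 - s) * ip x w)"
    by (simp add: power2_eq_square algebra_simps)
  then have 2: "2 * e - 3 * s \<le> (2 * (1 - s)) * ip x w" using s by simp
  have "c \<le> 2 * e - 3 * s" using e0 c_pos by (simp add: s_def)
  with 2 have 3: "c \<le> 2 * (1 - s) * ip x w" by simp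
  have "ip x w > 0"
  proof (rule ccontr)
    assume "\<not> ip x w > 0"
    then have "2 * (1 - s) * ip x w \<le> 0" using s by (intro mult_nonneg_nonpos) auto
    then show False using 3 c_pos by linarith
  qed
  then have "(1 - s) * ip x w \<le> 1 * ip x w" using s by (intro mult_right_mono) auto
  then show ?thesis using 3 unfolding mult.assoc by linarith
qed

text \<open>In the Hilbert space completion this is the squared norm of the projection of
  \<open>1\<close> onto the vectors invariant under \<open>multiples q\<close>, by the mean ergodic
  theorem.\<close>

definition energy :: "int \<Rightarrow> real" where
  "energy q = Inf ((\<lambda>a. ip a a) ` PM (multiples q))"

lemma multiples_subset: "multiples q \<subseteq> G"
  unfolding multiples_def using G_of_int by auto

lemma multiples_zero: "0 \<in> multiples q"
  unfolding multiples_def using G_0 by force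

lemma multiples_add: "v \<in> multiples q \<Longrightarrow> w \<in> multiples q \<Longrightarrow> v + w \<in> multiples q"
  unfolding multiples_def using G_add by (auto simp: distrib_left[symmetric])

lemma multiples_mult: "multiples (q * m) \<subseteq> multiples q"
  unfolding multiples_def using G_of_int by (auto simp: mult.assoc)

lemma energy_bdd: "bdd_below ((\<lambda>a. ip a a) ` PM (multiples q))"
  by (rule bdd_belowI[of _ 0]) (auto simp: ip_nonneg)

lemma energy_le: "a \<in> PM (multiples q) \<Longrightarrow> energy q \<le> ip a a"
  unfolding energy_def using energy_bdd by (intro cInf_lower) auto

lemma energy_ge: "c \<le> energy q"
  unfolding energy_def
proof (rule cInf_greatest)
  show "(\<lambda>a. ip a a) ` PM (multiples q) \<noteq> {}"
    using PM_one[OF multiples_zero] by blast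
qed (use ip_lower PM_mono[OF multiples_subset] in auto)

lemma energy_le_1: "energy q \<le> 1"
  using energy_le[OF PM_one[OF multiples_zero], of q] ip_one_le by linarith

lemma energy_near:
  assumes "\<epsilon> > 0"
  shows "\<exists>a \<in> PM (multiples q). ip a a < energy q + \<epsilon>"
proof -
  have "\<exists>x \<in> (\<lambda>a. ip a a) ` PM (multiples q). x < energy q + \<epsilon>"
    using assms PM_one[OF multiples_zero, of q] energy_bdd[of q]
    unfolding energy_def by (intro cInf_lessD) auto
  then show ?thesis by auto
qed

text \<open>\<open>k\<close> nearly attains the supremum of the energies, in which every
  \<open>k * m\<close> takes part as well.\<close>

lemma energy_saturates:
  assumes "\<epsilon> > 0"
  shows "\<exists>k\<ge>1. \<forall>m\<ge>1. energy (k * m) \<le> energy k + \<epsilon>"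
proof -
  have bdd: "bdd_above (energy ` {1..})" by (rule bdd_aboveI[of _ 1]) (auto simp: energy_le_1)
  have "\<exists>x \<in> energy ` {1..}. Sup (energy ` {1..}) - \<epsilon> < x"
    using assms by (intro less_cSupD) auto
  then obtain k where k: "k \<ge> 1" "Sup (energy ` {1..}) - \<epsilon> < energy k" by auto
  have "energy (k * m) \<le> energy k + \<epsilon>" if "m \<ge> 1" for m
  proof -
    have "1 * 1 \<le> k * m" using k that by (intro mult_mono) auto
    then have "energy (k * m) \<le> Sup (energy ` {1..})" by (intro cSup_upper bdd) auto
    then show ?thesis using k by simp
  qed
  then show ?thesis using k by blast
qed

text \<open>Write \<open>1 = \<mu> + h\<close> with \<open>\<mu>\<close> a near minimiser for the
  subgroup \<open>multiples (k * M)\<close>, and let \<open>\<nu>\<close> average over points of the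
  curves. By saturation \<open>\<nu> * \<mu>\<close> is still a near minimiser for
  \<open>multiples k\<close>, so it correlates with \<open>1\<close>; the curves span enough
  directions to make \<open>\<nu> * h\<close> small. The same \<open>k\<close> serves all curves
  because \<open>M\<close> is chosen after it.\<close>

theorem quadratic_curves_recurrence:
  "\<exists>k::int. k \<ge> 1 \<and> (\<forall>A B C r.
     (\<forall>i::nat. A i \<in> G \<and> B i \<in> G \<and> C i \<in> G) \<longrightarrow>
     (\<forall>I. finite I \<longrightarrow> card I = 2 ^ r \<longrightarrow>
        (\<exists>m::int. m \<ge> 1 \<and> (\<forall>g\<in>G. \<exists>z. of_int m * g = (\<Sum>i\<in>I. of_int (z i) * C i)))) \<longrightarrow>
     (\<exists>i t::nat. ip 1 (\<delta> (of_int k * (A i + of_nat t * B i + (of_nat t)\<^sup>2 * C i))) > 0))"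
proof -
  have c1: "c \<le> 1" using energy_ge energy_le_1 order_trans by blast
  \<comment> \<open>Half of the admissible slack \<open>c\<^sup>2 / 16\<close>: one
    \<open>\<epsilon>\<close> is lost in saturation, another in the choice of
    \<open>\<mu>\<close>.\<close>
  define \<epsilon> where "\<epsilon> = c\<^sup>2 / 32"
  have \<epsilon>: "\<epsilon> > 0" using c_pos by (simp add: \<epsilon>_def)
  obtain k :: int where k: "k \<ge> 1" "\<And>m. m \<ge> 1 \<Longrightarrow> energy (k * m) \<le> energy k + \<epsilon>"
    using energy_saturates[OF \<epsilon>] by blast
  have "\<exists>i t::nat. ip 1 (\<delta> (of_int k * (A i + of_nat t * B i + (of_nat t)\<^sup>2 * C i))) > 0"
    if ABC: "\<And>i::nat. A i \<in> G \<and> B i \<in> G \<and> C i \<in> G"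
      and span: "\<And>I. finite I \<Longrightarrow> card I = 2 ^ r \<Longrightarrow>
        (\<exists>m::int. m \<ge> 1 \<and> (\<forall>g\<in>G. \<exists>z. of_int m * g = (\<Sum>i\<in>I. of_int (z i) * C i)))"
    for A B C :: "nat \<Rightarrow> 'a" and r :: nat
  proof -
    \<comment> \<open>The allowance for \<open>(nm (\<nu> * h))\<^sup>2\<close>: a quarter of it for
      each of the three error terms of a curve, the last quarter for
      \<open>4 * \<theta>\<close>.\<close>
    define \<eta> where "\<eta> = c\<^sup>2 / 16"
    have \<eta>: "\<eta> > 0" using c_pos by (simp add: \<eta>_def)
    define \<theta> where "\<theta> = \<eta> / 16"
    have \<theta>: "\<theta> > 0" using \<eta> by (simp add: \<theta>_def)
    define \<sigma> where "\<sigma> = (\<theta>\<^sup>2 / 4) ^ (2 ^ r)"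
    have \<sigma>: "\<sigma> > 0" using \<theta> by (simp add: \<sigma>_def)
    \<comment> \<open>The parameters are fixed in the order \<open>S\<close>, \<open>L\<close>,
      \<open>M\<close>, \<open>\<mu>\<close>, \<open>H\<close>, \<open>T\<close>. In particular
      \<open>H\<close> depends on \<open>\<mu>\<close>, and \<open>T\<close> must be large compared
      with both \<open>S\<close> and \<open>H\<close>.\<close>
    obtain S :: nat where S: "S > 0" "8 / real S \<le> \<eta> / 4"
    proof -
      obtain S :: nat where "32 / \<eta> < real S" using reals_Archimedean2 by blast
      moreover from this have "real S > 0" using \<eta> by (smt (verit) divide_pos_pos)
      ultimately show ?thesis using \<eta> that[of S] by (auto simp: field_simps)
    qed
    obtain L :: nat where L: "L > 0" "real ((2 ^ r)\<^sup>2) / real L \<le> \<sigma> / 2"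
    proof -
      obtain L :: nat where "2 * real ((2 ^ r)\<^sup>2) / \<sigma> < real L" using reals_Archimedean2 by blast
      moreover from this have "real L > 0" using \<sigma> by (smt (verit) divide_nonneg_pos of_nat_0_le_iff)
      ultimately show ?thesis using \<sigma> that[of L] by (auto simp: field_simps)
    qed
    define Is where "Is = {I. I \<subseteq> {..<L} \<and> card I = 2 ^ r}"
    have finIs: "finite Is" unfolding Is_def by simp
    have "\<forall>I\<in>Is. \<exists>m::int. m \<ge> 1 \<and> (\<forall>g\<in>G. \<exists>z. of_int m * g = (\<Sum>i\<in>I. of_int (z i) * C i))"
      using span finite_subset unfolding Is_def by blast
    then obtain mI :: "nat set \<Rightarrow> int" where mI: "\<And>I. I \<in> Is \<Longrightarrow> mI I \<ge> 1"
      "\<And>I g. I \<in> Is \<Longrightarrow> g \<in> G \<Longrightarrow> \<exists>z. of_int (mI I) * g = (\<Sum>i\<in>I. of_int (z i) * C i)"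
      by metis
    \<comment> \<open>The product clears the denominators \<open>mI I\<close> of all index sets in
      \<open>Is\<close> at once; \<open>2 * fact S\<close> matches the step of \<open>w\<close>, so
      that \<open>multiples (k * M)\<close> lies in the integer span of the \<open>w i\<close> for
      every such \<open>I\<close>.\<close>
    define M where "M = 2 * fact S * (\<Prod>I\<in>Is. mI I)"
    have prod1: "(\<Prod>I\<in>Is. mI I) \<ge> 1" using mI by (intro prod_ge_1) auto
    have "2 * fact S \<ge> (1::int)" using fact_ge_1[of S, where 'a=int] by linarith
    then have M1: "M \<ge> 1" unfolding M_def using mult_mono[of 1 "2 * fact S" 1 "\<Prod>I\<in>Is. mI I"] prod1 by auto
    define w where "w i = of_int (2 * fact S * k) * C i" for i
    have w: "w i \<in> G" for i unfolding w_def using ABC by (intro G_of_int) auto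
    have rep: "\<exists>z. g = (\<Sum>i\<in>I. of_int (z i) * w i)" if I: "I \<in> Is" and g: "g \<in> multiples (k * M)" for I g
    proof -
      obtain g0 where g0: "g0 \<in> G" "g = of_int (k * M) * g0" using g unfolding multiples_def by auto
      obtain z where z: "of_int (mI I) * g0 = (\<Sum>i\<in>I. of_int (z i) * C i)" using mI(2)[OF I g0(1)] by blast
      define m' where "m' = (\<Prod>I\<in>Is - {I}. mI I)"
      have "(\<Prod>I\<in>Is. mI I) = mI I * m'" unfolding m'_def using finIs I by (rule prod.remove)
      then have "g = of_int (2 * fact S * k * m') * (of_int (mI I) * g0)"
        unfolding g0(2) M_def by (simp add: ac_simps)
      also have "\<dots> = (\<Sum>i\<in>I. of_int (m' * z i) * w i)"
        unfolding z sum_distrib_left w_def by (simp add: ac_simps)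
      finally show ?thesis by (rule exI[of _ "\<lambda>i. m' * z i"])
    qed
    obtain \<mu> where \<mu>: "\<mu> \<in> PM (multiples (k * M))" "ip \<mu> \<mu> < energy (k * M) + \<epsilon>"
      using energy_near[OF \<epsilon>] by blast
    have \<mu>k: "\<mu> \<in> PM (multiples k)" using PM_mono[OF multiples_mult] \<mu> by blast
    have \<mu>G: "\<mu> \<in> PM G" using PM_mono[OF multiples_subset] \<mu> by blast
    define h where "h = 1 - \<mu>"
    have h: "nm h \<le> 2"
      using nm_triangle_diff[of 1 \<mu>] nm_PM[OF \<mu>G, of 1] nm_one_le by (simp add: h_def)
    have "\<forall>I\<in>Is. \<exists>D. \<forall>H. nm ((\<Prod>i\<in>I. (gam (w i) H)\<^sup>2) * h) \<le> D / real (2 * H + 1)"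
    proof
      fix I assume I: "I \<in> Is"
      then have "finite I" unfolding Is_def using finite_subset by blast
      then show "\<exists>D. \<forall>H. nm ((\<Prod>i\<in>I. (gam (w i) H)\<^sup>2) * h) \<le> D / real (2 * H + 1)"
        unfolding h_def using w rep[OF I] by (intro almost_invariant_product[OF _ _ \<mu>(1)]) auto
    qed
    then obtain D where D: "\<And>I H. I \<in> Is \<Longrightarrow> nm ((\<Prod>i\<in>I. (gam (w i) H)\<^sup>2) * h) \<le> D I / real (2 * H + 1)"
      by metis
    obtain H :: nat where H: "(\<Sum>I\<in>Is. \<bar>D I\<bar>) / \<sigma> < real H" using reals_Archimedean2 by blast
    have small: "nm ((\<Prod>i\<in>I. (gam (w i) H)\<^sup>2) * h) \<le> \<sigma>" if "I \<subseteq> {..<L}" "card I = 2 ^ r" for I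
    proof -
      have I: "I \<in> Is" using that by (simp add: Is_def)
      have "D I \<le> (\<Sum>I\<in>Is. \<bar>D I\<bar>)"
        using member_le_sum[OF I, of "\<lambda>I. \<bar>D I\<bar>"] finIs by fastforce
      also have "\<dots> \<le> \<sigma> * real H" using H \<sigma> by (simp add: field_simps)
      also have "\<dots> \<le> \<sigma> * real (2 * H + 1)" using \<sigma> by (intro mult_left_mono) auto
      finally have "D I / real (2 * H + 1) \<le> \<sigma>" by (simp add: divide_le_eq)
      then show ?thesis using D[OF I, of H] by linarith
    qed
    have avg: "(1 / real L) * (\<Sum>i<L. nm (gam (w i) H * h)) \<le> \<theta>"
      by (rule average_gam_small[OF h \<theta> w L(1) L(2)[unfolded \<sigma>_def] small[unfolded \<sigma>_def]])
    obtain T :: nat where T: "T > 0" "32 * (real S)\<^sup>2 / (real T)\<^sup>2 \<le> \<eta> / 4" "16 * real H * fact S / real T \<le> \<eta> / 4"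
    proof -
      obtain T :: nat where T: "128 * (real S)\<^sup>2 / \<eta> + 64 * real H * fact S / \<eta> + 1 < real T" using reals_Archimedean2 by blast
      have p: "128 * (real S)\<^sup>2 / \<eta> \<ge> 0" "64 * real H * fact S / \<eta> \<ge> 0" using \<eta> by auto
      then have T1: "real T \<ge> 1" using T by linarith
      have "128 * (real S)\<^sup>2 / \<eta> \<le> real T" "64 * real H * fact S / \<eta> \<le> real T" using T p by linarith+
      then have "128 * (real S)\<^sup>2 \<le> \<eta> * real T" and b: "64 * real H * fact S \<le> \<eta> * real T"
        using \<eta> by (auto simp: field_simps)
      moreover have "\<eta> * (real T * 1) \<le> \<eta> * (real T * real T)"
        using T1 \<eta> by (intro mult_left_mono) auto
      ultimately have "128 * (real S)\<^sup>2 \<le> \<eta> * (real T)\<^sup>2"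
        unfolding power2_eq_square by linarith
      with b T1 show ?thesis using that[of T] by (simp add: field_simps)
    qed
    define P where "P i t = of_int k * (A i + of_nat t * B i + (of_nat t)\<^sup>2 * C i)" for i t :: nat
    define \<nu>i where "\<nu>i i = (1 / real T) *\<^sub>R (\<Sum>t<T. \<delta> (P i t))" for i
    define \<nu> where "\<nu> = (1 / real L) *\<^sub>R (\<Sum>i<L. \<nu>i i)"
    have PG: "P i t \<in> multiples k" for i t
    proof -
      have "A i + of_nat t * B i + of_nat (t * t) * C i \<in> G"
        using ABC by (intro G_add G_of_nat) auto
      then show ?thesis unfolding P_def multiples_def by (simp add: power2_eq_square)
    qed
    have \<nu>PM: "\<nu> \<in> PM (multiples k)"
      unfolding \<nu>_def \<nu>i_def by (intro PM_average L T PM_delta PG)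
    have \<nu>ih: "(nm (\<nu>i i * h))\<^sup>2 \<le> 3 * \<eta> / 4 + 4 * nm (gam (w i) H * h)" for i
    proof -
      have "(nm (\<nu>i i * h))\<^sup>2 \<le> 2 * (2 * real S * 2 / real T)\<^sup>2 + 2 * (2\<^sup>2 / real S
        + 2 * (nm (gam (w i) H * h) + 2 * real H * fact S / real T * 2))"
        unfolding \<nu>i_def P_def w_def
        by (rule curve_average_bound) (use ABC S T h in auto)
      also have "\<dots> = 32 * (real S)\<^sup>2 / (real T)\<^sup>2 + 8 / real S + 4 * nm (gam (w i) H * h) + 16 * real H * fact S / real T"
        by (simp add: power_divide power_mult_distrib)
      also have "\<dots> \<le> \<eta> / 4 + \<eta> / 4 + 4 * nm (gam (w i) H * h) + \<eta> / 4"
        using S T by (intro add_mono) auto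
      finally show ?thesis by simp
    qed
    have "(nm (\<nu> * h))\<^sup>2 \<le> (1 / real L) * (\<Sum>i<L. (nm (\<nu>i i * h))\<^sup>2)"
      using nm_average_square_le[OF L(1), of "\<lambda>i. \<nu>i i * h"] by (simp add: \<nu>_def sum_distrib_right)
    also have "\<dots> \<le> (1 / real L) * (\<Sum>i<L. 3 * \<eta> / 4 + 4 * nm (gam (w i) H * h))"
      by (intro mult_left_mono sum_mono \<nu>ih) auto
    also have "\<dots> = 3 * \<eta> / 4 + 4 * ((1 / real L) * (\<Sum>i<L. nm (gam (w i) H * h)))"
      using L by (simp add: sum.distrib distrib_left sum_distrib_left[symmetric])
    also have "\<dots> \<le> 3 * \<eta> / 4 + 4 * \<theta>" using avg by (intro add_left_mono mult_left_mono) auto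
    also have "\<dots> = (c / 4)\<^sup>2" by (simp add: \<theta>_def \<eta>_def power_divide)
    finally have \<nu>h: "nm (\<nu> * h) \<le> c / 4" by (rule power2_le_imp_le) (use c_pos in simp)
    \<comment> \<open>Averaging does not increase the norm, so \<open>\<nu> * \<mu>\<close> inherits
      the near minimality of \<open>\<mu>\<close>, now relative to the larger subgroup
      \<open>multiples k\<close>.\<close>
    have "nm (\<nu> * \<mu>) \<le> nm \<mu>" using nm_PM PM_mono[OF multiples_subset \<nu>PM] by blast
    then have "(nm (\<nu> * \<mu>))\<^sup>2 \<le> (nm \<mu>)\<^sup>2" by (intro power_mono) auto
    then have "ip (\<nu> * \<mu>) (\<nu> * \<mu>) \<le> ip \<mu> \<mu>" by (simp add: nm_square)
    also have "\<dots> \<le> energy k + c\<^sup>2 / 16" using \<mu>(2) k(2)[OF M1] by (simp add: \<epsilon>_def)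
    finally have near: "ip (\<nu> * \<mu>) (\<nu> * \<mu>) \<le> energy k + c\<^sup>2 / 16" .
    have "\<nu> * \<mu> \<in> PM (multiples k)" by (rule PM_mult[OF multiples_add \<nu>PM \<mu>k])
    then have main: "c / 2 \<le> ip 1 (\<nu> * \<mu>)"
      by (rule near_minimiser_ip_lower[OF PM_one[OF multiples_zero] ip_one_le _ energy_le energy_ge energy_le_1 near])
    have "\<bar>ip 1 (\<nu> * h)\<bar> \<le> 1 * (c / 4)"
      using ip_abs_le[of 1 "\<nu> * h"] mult_mono[OF nm_one_le \<nu>h] by simp
    moreover have "ip 1 \<nu> = ip 1 (\<nu> * \<mu>) + ip 1 (\<nu> * h)"
      by (simp add: h_def ip_add_right[symmetric] distrib_left[symmetric])
    ultimately have pos: "ip 1 \<nu> > 0" using main c_pos by linarith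
    have "\<exists>i t. ip 1 (\<delta> (P i t)) > 0"
    proof (rule ccontr)
      assume "\<not> ?thesis"
      then have "ip 1 (\<delta> (P i t)) \<le> 0" for i t by (meson not_le)
      then have "ip 1 \<nu> \<le> 0"
        unfolding \<nu>_def \<nu>i_def ip_scaleR_right ip_sum_right
        by (intro mult_nonneg_nonpos sum_nonpos) auto
      with pos show False by simp
    qed
    then show ?thesis unfolding P_def .
  qed
  then show ?thesis using k(1) by blast
qed

end

subsection \<open>The form of a set of positive density\<close>

instantiation poly_mapping :: (comm_monoid_add, "{comm_ring_1,real_algebra_1}") real_algebra_1
begin

text \<open>Scaling is multiplication by a constant of the group ring, which reduces the algebra
  laws to ring laws.\<close>

definition scaleR_poly_mapping :: "real \<Rightarrow> ('a \<Rightarrow>\<^sub>0 'b) \<Rightarrow> ('a \<Rightarrow>\<^sub>0 'b)" where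
  "scaleR_poly_mapping r p = Poly_Mapping.single 0 (of_real r) * p"

instance
proof
  fix a b :: real and x y :: "'a \<Rightarrow>\<^sub>0 'b"
  show "a *\<^sub>R (x + y) = a *\<^sub>R x + a *\<^sub>R y" "(a + b) *\<^sub>R x = a *\<^sub>R x + b *\<^sub>R x"
    by (simp_all add: scaleR_poly_mapping_def single_add algebra_simps)
  show "a *\<^sub>R b *\<^sub>R x = (a * b) *\<^sub>R x"
    by (simp add: scaleR_poly_mapping_def mult.assoc[symmetric] mult_single)
  show "1 *\<^sub>R x = x" by (simp add: scaleR_poly_mapping_def)
  show "a *\<^sub>R x * y = a *\<^sub>R (x * y)" "x * a *\<^sub>R y = a *\<^sub>R (x * y)"
    by (simp_all add: scaleR_poly_mapping_def ac_simps)
qed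

end

text \<open>Tychonoff: the sequence runs in a compact product of intervals, so it has a cluster
  point along \<open>F\<close>. The index type is arbitrary, possibly uncountable, hence a finer
  filter instead of a diagonal subsequence.\<close>

lemma bounded_family_limit:
  fixes s :: "nat \<Rightarrow> 'i \<Rightarrow> real"
  assumes F: "F \<noteq> bot" and bd: "\<And>i. \<exists>C. \<forall>n. \<bar>s n i\<bar> \<le> C"
  shows "\<exists>F' l. F' \<noteq> bot \<and> F' \<le> F \<and> (\<forall>i. ((\<lambda>n. s n i) \<longlongrightarrow> l i) F')"
proof -
  obtain C where C: "\<And>i n. \<bar>s n i\<bar> \<le> C i" using bd by metis
  define K where "K = PiE UNIV (\<lambda>i. {- C i..C i})"
  have "compactin (product_topology (\<lambda>i. euclidean) UNIV) K"
    unfolding K_def by (subst compactin_PiE) (auto simp: compactin_euclidean_iff)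
  then have "compact K" by (simp add: euclidean_product_topology compactin_euclidean_iff)
  moreover have sK: "s n \<in> K" for n
    unfolding K_def PiE_UNIV_domain using C by (auto simp: abs_le_iff minus_le_iff)
  ultimately obtain x where x: "inf (nhds x) (filtermap s F) \<noteq> bot"
    using F unfolding compact_filter by (metis always_eventually eventually_filtermap filtermap_bot_iff)
  \<comment> \<open>Pulling back the neighbourhoods of the cluster point forces convergence; that
    \<open>x\<close> is a cluster point is exactly what keeps this filter proper.\<close>
  define F' where "F' = inf F (filtercomap s (nhds x))"
  have "F' \<noteq> bot"
  proof
    assume "F' = bot"
    then have "eventually (\<lambda>_. False) F'" by simp
    then obtain P Q where PQ: "eventually P F" "eventually Q (filtercomap s (nhds x))"
      "\<And>n. P n \<Longrightarrow> Q n \<Longrightarrow> False"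
      unfolding F'_def eventually_inf by blast
    obtain Q' where Q': "eventually Q' (nhds x)" "\<And>n. Q' (s n) \<Longrightarrow> Q n"
      using PQ(2) unfolding eventually_filtercomap by blast
    have "eventually (\<lambda>y. \<not> Q' y) (filtermap s F)"
      unfolding eventually_filtermap using PQ(1) by (rule eventually_mono) (use PQ(3) Q'(2) in blast)
    then have "eventually (\<lambda>_. False) (inf (nhds x) (filtermap s F))"
      using Q'(1) unfolding eventually_inf by blast
    then show False using x by (simp add: trivial_limit_def)
  qed
  moreover have "F' \<le> F" by (simp add: F'_def)
  moreover have "((\<lambda>n. s n i) \<longlongrightarrow> x i) F'" for i
  proof -
    have s: "(s \<longlongrightarrow> x) F'"
      unfolding F'_def by (rule filterlim_mono[OF filterlim_filtercomap]) auto
    show ?thesis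
    proof (rule topological_tendstoI)
      fix S :: "real set" assume S: "open S" "x i \<in> S"
      have "open ((\<lambda>y. y i) -` S)" by (rule open_vimage[OF S(1)]) simp
      from topological_tendstoD[OF s this] S(2) show "eventually (\<lambda>n. s n i \<in> S) F'" by simp
    qed
  qed
  ultimately show ?thesis by blast
qed

text \<open>The sums differ only on \<open>B\<close> minus its translate and on the translate minus
  \<open>B\<close>, and these have equal size because translation preserves cardinality.\<close>

lemma sum_translate_diff_le:
  fixes g :: "'a::ab_group_add \<Rightarrow> real"
  assumes B: "finite B" and g: "\<And>x. \<bar>g x\<bar> \<le> C"
  shows "\<bar>(\<Sum>x\<in>B. g (x + v)) - (\<Sum>x\<in>B. g x)\<bar> \<le> 2 * C * real (card {x\<in>B. x + v \<notin> B})"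
proof -
  let ?B = "(\<lambda>x. x + v) ` B"
  have inj: "inj_on (\<lambda>x. x + v) A" for A by (auto intro: inj_onI)
  have c: "card (?B - B) = card {x\<in>B. x + v \<notin> B}"
  proof -
    have "?B - B = (\<lambda>x. x + v) ` {x\<in>B. x + v \<notin> B}" by auto
    then show ?thesis by (simp add: card_image[OF inj])
  qed
  have c': "card (B - ?B) = card (?B - B)"
  proof -
    have "card B = card ?B" by (simp add: card_image[OF inj])
    then show ?thesis using B
      by (metis card_Diff_subset_Int finite_Int finite_imageI inf_commute)
  qed
  have bnd: "\<bar>sum g A\<bar> \<le> C * real (card A)" for A
    using order_trans[OF sum_abs sum_bounded_above[of A "\<lambda>x. \<bar>g x\<bar>" C]] g by (simp add: mult.commute)
  have "(\<Sum>x\<in>B. g (x + v)) = sum g ?B" by (simp add: sum.reindex[OF inj])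
  also have "\<dots> = sum g (?B - B) + sum g (?B \<inter> B)"
    using B by (metis add.commute finite_imageI sum.Int_Diff)
  finally have 1: "(\<Sum>x\<in>B. g (x + v)) = sum g (?B - B) + sum g (?B \<inter> B)" .
  have 2: "sum g B = sum g (B - ?B) + sum g (?B \<inter> B)"
    using B by (metis add.commute inf_commute sum.Int_Diff)
  show ?thesis using bnd[of "?B - B"] bnd[of "B - ?B"] unfolding 1 2 c' c by linarith
qed

text \<open>The group ring element \<open>a\<close> acting by translations on the indicator of
  \<open>E\<close>. The form will be the limiting mean of products of two such functions.\<close>

definition translate_comb :: "'a::comm_monoid_add set \<Rightarrow> ('a \<Rightarrow>\<^sub>0 real) \<Rightarrow> 'a \<Rightarrow> real" where
  "translate_comb E a x = (\<Sum>v\<in>Poly_Mapping.keys a. Poly_Mapping.lookup a v * indicat_real E (x + v))"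

context
  fixes E :: "'a::comm_monoid_add set"
begin

lemma translate_comb_superset:
  assumes "finite S" "Poly_Mapping.keys a \<subseteq> S"
  shows "translate_comb E a x = (\<Sum>v\<in>S. Poly_Mapping.lookup a v * indicat_real E (x + v))"
  unfolding translate_comb_def
  using assms by (intro sum.mono_neutral_left) (auto simp: in_keys_iff)

lemma translate_comb_add: "translate_comb E (a + b) x = translate_comb E a x + translate_comb E b x"
proof -
  let ?S = "Poly_Mapping.keys a \<union> Poly_Mapping.keys b"
  have "Poly_Mapping.keys (a + b) \<subseteq> ?S" by (rule Poly_Mapping.keys_add)
  then show ?thesis
    by (simp add: translate_comb_superset[of ?S] lookup_add distrib_right sum.distrib)
qed

lemma translate_comb_zero [simp]: "translate_comb E 0 x = 0"
  by (simp add: translate_comb_def)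

lemma translate_comb_single: "translate_comb E (Poly_Mapping.single v r) x = r * indicat_real E (x + v)"
  by (cases "r = 0") (simp_all add: translate_comb_def)

lemma translate_comb_sum: "translate_comb E (\<Sum>i\<in>I. f i) x = (\<Sum>i\<in>I. translate_comb E (f i) x)"
  by (induction I rule: infinite_finite_induct) (auto simp: translate_comb_add)

lemma poly_mapping_eq_sum_single:
  "a = (\<Sum>v\<in>Poly_Mapping.keys a. Poly_Mapping.single v (Poly_Mapping.lookup a v))"
  by (rule poly_mapping_eqI)
    (simp add: lookup_sum lookup_single when_def sum.If_cases in_keys_iff)

lemma translate_comb_single_mult:
  "translate_comb E (Poly_Mapping.single w r * a) x = r * translate_comb E a (x + w)"
proof -
  have "Poly_Mapping.single w r * a
      = (\<Sum>v\<in>Poly_Mapping.keys a. Poly_Mapping.single (w + v) (r * Poly_Mapping.lookup a v))"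
    by (subst (1) poly_mapping_eq_sum_single[of a]) (simp add: sum_distrib_left mult_single)
  then show ?thesis
    by (simp add: translate_comb_sum translate_comb_single translate_comb_def[of E a] sum_distrib_left ac_simps)
qed

lemma translate_comb_scaleR: "translate_comb E (r *\<^sub>R a) x = r * translate_comb E a x"
  by (simp add: scaleR_poly_mapping_def translate_comb_single_mult)

lemma translate_comb_one: "translate_comb E 1 x = indicat_real E x"
  using translate_comb_single[of 0 1 x] by simp

lemma translate_comb_bounded: "\<exists>C. \<forall>x. \<bar>translate_comb E a x\<bar> \<le> C"
proof -
  have "\<bar>translate_comb E a x\<bar> \<le> (\<Sum>v\<in>Poly_Mapping.keys a. \<bar>Poly_Mapping.lookup a v\<bar>)" for x
    unfolding translate_comb_def
    by (rule order_trans[OF sum_abs sum_mono]) (auto simp: indicator_def)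
  then show ?thesis by blast
qed

end

text \<open>The form is the limit of box averages of products along a filter on which the density
  stays at least \<open>\<delta>\<close>. The Folner condition makes it invariant. A convex
  combination of translates of the indicator has asymptotically the mean of the indicator, so its
  mean square is at least \<open>\<delta>\<^sup>2\<close>.\<close>

lemma shift_form_of_Folner:
  fixes Bx :: "nat \<Rightarrow> 'a::comm_ring_1 set" and E G :: "'a set" and \<delta> :: real
  assumes fin: "\<And>n. finite (Bx n)" and ne: "\<And>n. Bx n \<noteq> {}"
    and G: "0 \<in> G" "\<And>v w. v \<in> G \<Longrightarrow> w \<in> G \<Longrightarrow> v + w \<in> G" "\<And>v. v \<in> G \<Longrightarrow> - v \<in> G"
    and Folner: "\<And>v. v \<in> G \<Longrightarrow> (\<lambda>n. real (card {x\<in>Bx n. x + v \<notin> Bx n}) / real (card (Bx n))) \<longlonglongrightarrow> 0"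
    and \<delta>: "\<delta> > 0" and dens: "\<exists>\<^sub>F n in sequentially. \<delta> \<le> real (card (E \<inter> Bx n)) / real (card (Bx n))"
  shows "\<exists>ip. shift_form ip (\<lambda>v. Poly_Mapping.single v 1 :: 'a \<Rightarrow>\<^sub>0 real) G (\<delta>\<^sup>2) \<and>
    (\<forall>v. ip 1 (Poly_Mapping.single v 1) > 0 \<longrightarrow> (\<exists>x\<in>E. x + v \<in> E))"
proof -
  \<comment> \<open>Only frequently many \<open>n\<close> have density at least
    \<open>\<delta>\<close>; restricting the filter to them turns a bound on a limsup into an
    eventual one.\<close>
  define D where "D = {n. \<delta> \<le> real (card (E \<inter> Bx n)) / real (card (Bx n))}"
  define F where "F = inf sequentially (principal D)"
  have F: "F \<noteq> bot"
    using dens unfolding F_def trivial_limit_def eventually_inf_principal D_def frequently_def by simp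
  define m where "m n g = (\<Sum>x\<in>Bx n. g x) / real (card (Bx n))" for n and g :: "'a \<Rightarrow> real"
  have card: "real (card (Bx n)) > 0" for n using fin ne by (simp add: card_gt_0_iff)
  have m_bd: "\<bar>m n g\<bar> \<le> C" if "\<And>x. \<bar>g x\<bar> \<le> C" for n g C
  proof -
    have "\<bar>sum g (Bx n)\<bar> \<le> real (card (Bx n)) * C"
      using order_trans[OF sum_abs sum_bounded_above[of "Bx n" "\<lambda>x. \<bar>g x\<bar>" C]] that by simp
    then show ?thesis using card[of n] by (simp add: m_def field_simps)
  qed
  have m_add: "m n (\<lambda>x. g x + g' x) = m n g + m n g'" for n g g'
    by (simp add: m_def sum.distrib add_divide_distrib)
  have m_scale: "m n (\<lambda>x. r * g x) = r * m n g" for n g r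
    by (simp add: m_def sum_distrib_left)
  have m_shift: "(\<lambda>n. m n (\<lambda>x. g (x + v)) - m n g) \<longlonglongrightarrow> 0"
    if v: "v \<in> G" and g: "\<And>x. \<bar>g x\<bar> \<le> C" for v g C
  proof (rule Lim_null_comparison)
    show "\<forall>\<^sub>F n in sequentially. norm (m n (\<lambda>x. g (x + v)) - m n g)
        \<le> 2 * C * (real (card {x\<in>Bx n. x + v \<notin> Bx n}) / real (card (Bx n)))"
    proof (rule always_eventually, rule allI)
      fix n
      have "m n (\<lambda>x. g (x + v)) - m n g = ((\<Sum>x\<in>Bx n. g (x + v)) - (\<Sum>x\<in>Bx n. g x)) / real (card (Bx n))"
        by (simp add: m_def diff_divide_distrib)
      then show "norm (m n (\<lambda>x. g (x + v)) - m n g)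
        \<le> 2 * C * (real (card {x\<in>Bx n. x + v \<notin> Bx n}) / real (card (Bx n)))"
        using sum_translate_diff_le[OF fin[of n], of g C v, OF g] card[of n] by (simp add: divide_right_mono)
    qed
    show "(\<lambda>n. 2 * C * (real (card {x\<in>Bx n. x + v \<notin> Bx n}) / real (card (Bx n)))) \<longlonglongrightarrow> 0"
      using tendsto_mult_right_zero[OF Folner[OF v], of "2 * C"] by simp
  qed
  define s where "s n ab = m n (\<lambda>x. translate_comb E (fst ab) x * translate_comb E (snd ab) x)"
    for n and ab :: "('a \<Rightarrow>\<^sub>0 real) \<times> ('a \<Rightarrow>\<^sub>0 real)"
  have prod_bd: "\<exists>C. \<forall>x. \<bar>translate_comb E a x * translate_comb E b x\<bar> \<le> C" for a b :: "'a \<Rightarrow>\<^sub>0 real"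
  proof -
    obtain C C' where "\<And>x. \<bar>translate_comb E a x\<bar> \<le> C" "\<And>x. \<bar>translate_comb E b x\<bar> \<le> C'"
      using translate_comb_bounded by metis
    then have "\<bar>translate_comb E a x * translate_comb E b x\<bar> \<le> C * C'" for x
      unfolding abs_mult by (intro mult_mono) (auto intro: order_trans[OF abs_ge_zero])
    then show ?thesis by blast
  qed
  have "\<exists>C. \<forall>n. \<bar>s n ab\<bar> \<le> C" for ab
    using prod_bd[of "fst ab" "snd ab"] m_bd unfolding s_def by meson
  from bounded_family_limit[of F s, OF F this] obtain F' l where F': "F' \<noteq> bot" "F' \<le> F"
    and l: "\<And>ab. ((\<lambda>n. s n ab) \<longlongrightarrow> l ab) F'" by blast
  have F'seq: "F' \<le> sequentially" using F' by (simp add: F_def)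
  have inD: "eventually (\<lambda>n. n \<in> D) F'"
    using F'(2) unfolding F_def by (simp add: le_principal)
  define ip where "ip a b = l (a, b)" for a b
  have lim: "((\<lambda>n. m n (\<lambda>x. translate_comb E a x * translate_comb E b x)) \<longlongrightarrow> ip a b) F'" for a b
    using l[of "(a, b)"] by (simp add: s_def ip_def)
  note uniq = tendsto_unique[OF F'(1)]
  let ?\<delta> = "\<lambda>v. Poly_Mapping.single v 1 :: 'a \<Rightarrow>\<^sub>0 real"
  have "shift_form ip ?\<delta> G (\<delta>\<^sup>2)"
  proof
    fix a b c :: "'a \<Rightarrow>\<^sub>0 real" and r :: real and v w :: 'a
    show "ip (a + b) c = ip a c + ip b c"
      using uniq[OF lim[of "a + b" c]] tendsto_add[OF lim[of a c] lim[of b c]]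
      by (simp add: translate_comb_add distrib_right m_add)
    show "ip (r *\<^sub>R a) c = r * ip a c"
      using uniq[OF lim[of "r *\<^sub>R a" c]] tendsto_mult_left[OF lim[of a c], of r]
      by (simp add: translate_comb_scaleR mult.assoc m_scale)
    show "ip a b = ip b a"
      using uniq[OF lim[of a b]] lim[of b a] by (simp add: mult.commute)
    show "0 \<le> ip a a"
      by (rule tendsto_lowerbound[OF lim always_eventually F'(1)])
        (auto simp: m_def intro!: divide_nonneg_nonneg sum_nonneg)
    show "?\<delta> 0 = 1" by simp
    show "?\<delta> (v + w) = ?\<delta> v * ?\<delta> w" by (simp add: mult_single)
    show "0 \<in> G" by (rule G)
    show "v \<in> G \<Longrightarrow> w \<in> G \<Longrightarrow> v + w \<in> G" by (rule G)
    show "v \<in> G \<Longrightarrow> - v \<in> G" by (rule G)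
    show "ip (?\<delta> v * a) (?\<delta> v * b) = ip a b" if v: "v \<in> G"
    proof -
      obtain C where C: "\<And>x. \<bar>translate_comb E a x * translate_comb E b x\<bar> \<le> C"
        using prod_bd by blast
      have "((\<lambda>n. m n (\<lambda>x. translate_comb E a (x + v) * translate_comb E b (x + v))
          - m n (\<lambda>x. translate_comb E a x * translate_comb E b x)) \<longlongrightarrow> 0) F'"
        by (rule tendsto_mono[OF F'seq m_shift[where g = "\<lambda>x. translate_comb E a x * translate_comb E b x", OF v C]])
      from tendsto_add[OF this lim[of a b]] show ?thesis
        using uniq[OF lim[of "?\<delta> v * a" "?\<delta> v * b"]] by (simp add: translate_comb_single_mult)
    qed
    show "ip 1 1 \<le> 1"
    proof (rule tendsto_upperbound[OF lim always_eventually F'(1)], rule allI)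
      fix n
      show "m n (\<lambda>x. translate_comb E 1 x * translate_comb E 1 x) \<le> 1"
        using m_bd[of "\<lambda>x. translate_comb E 1 x * translate_comb E 1 x" 1 n]
        by (simp add: translate_comb_one indicator_def abs_le_iff)
    qed
    show "0 < \<delta>\<^sup>2" using \<delta> by simp
    show "\<delta>\<^sup>2 \<le> ip a a" if a: "a \<in> convex hull (?\<delta> ` G)"
    proof -
      \<comment> \<open>The discrepancy between the mean of the convex combination and the density;
        it vanishes in the limit by approximate invariance.\<close>
      define d where "d n = m n (translate_comb E a) - m n (translate_comb E 1)" for n
      have "(\<lambda>n. m n (translate_comb E a) - m n (translate_comb E 1)) \<longlonglongrightarrow> 0"
        using a
      proof (rule hull_induct)
        fix y assume "y \<in> ?\<delta> ` G"
        then obtain v where v: "v \<in> G" "y = ?\<delta> v" by blast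
        have "\<bar>indicat_real E x\<bar> \<le> 1" for x by (simp add: indicator_def)
        from m_shift[where g = "indicat_real E", OF v(1) this]
        show "(\<lambda>n. m n (translate_comb E y) - m n (translate_comb E 1)) \<longlonglongrightarrow> 0"
          by (simp add: v(2) translate_comb_single translate_comb_one[abs_def] translate_comb_single[abs_def])
      next
        show "convex {y. (\<lambda>n. m n (translate_comb E y) - m n (translate_comb E 1)) \<longlonglongrightarrow> 0}"
        proof (rule convexI, goal_cases)
          case (1 y z p q)
          have eq: "translate_comb E (p *\<^sub>R y + q *\<^sub>R z) = (\<lambda>x. p * translate_comb E y x + q * translate_comb E z x)"
            by (rule ext) (simp add: translate_comb_add translate_comb_scaleR)
          have "m n (translate_comb E (p *\<^sub>R y + q *\<^sub>R z)) - m n (translate_comb E 1)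
              = p * (m n (translate_comb E y) - m n (translate_comb E 1))
                + q * (m n (translate_comb E z) - m n (translate_comb E 1))" for n
          proof -
            have "m n (translate_comb E 1) = (p + q) * m n (translate_comb E 1)" using 1 by simp
            then show ?thesis unfolding eq m_add m_scale by (simp add: algebra_simps)
          qed
          moreover have "(\<lambda>n. p * (m n (translate_comb E y) - m n (translate_comb E 1))
                + q * (m n (translate_comb E z) - m n (translate_comb E 1))) \<longlonglongrightarrow> p * 0 + q * 0"
            using 1 by (intro tendsto_intros) auto
          ultimately show ?case by simp
        qed
      qed
      then have "(d \<longlongrightarrow> 0) F'" unfolding d_def[abs_def] by (rule tendsto_mono[OF F'seq])
      then have "((\<lambda>n. \<delta>\<^sup>2 + 2 * \<delta> * d n) \<longlongrightarrow> \<delta>\<^sup>2 + 2 * \<delta> * 0) F'"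
        by (intro tendsto_intros)
      moreover have "eventually (\<lambda>n. \<delta>\<^sup>2 + 2 * \<delta> * d n \<le> m n (\<lambda>x. translate_comb E a x * translate_comb E a x)) F'"
        using inD
      proof (rule eventually_mono)
        fix n assume n: "n \<in> D"
        let ?M = "m n (translate_comb E a)"
        have "m n (translate_comb E 1) = real (card (E \<inter> Bx n)) / real (card (Bx n))"
          using fin[of n]
          by (simp add: m_def translate_comb_one[abs_def] indicator_def sum.If_cases Int_def conj_commute)
        then have "\<delta> \<le> m n (translate_comb E 1)" using n by (simp add: D_def)
        then have "\<delta> * (\<delta> + d n) \<le> \<delta> * ?M" using \<delta> by (intro mult_left_mono) (auto simp: d_def)
        then have "\<delta>\<^sup>2 + 2 * \<delta> * d n \<le> 2 * \<delta> * ?M - \<delta>\<^sup>2"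
          by (simp add: power2_eq_square algebra_simps)
        also have "\<dots> = m n (\<lambda>x. 2 * \<delta> * translate_comb E a x + (- (\<delta>\<^sup>2)))"
        proof -
          have "m n (\<lambda>_. - (\<delta>\<^sup>2)) = - (\<delta>\<^sup>2)" using card[of n] by (simp add: m_def)
          then show ?thesis by (simp only: m_add m_scale)
        qed
        \<comment> \<open>The pointwise inequality
          \<open>2 * \<delta> * y - \<delta>\<^sup>2 \<le> y\<^sup>2\<close> replaces Cauchy-Schwarz
          for the mean.\<close>
        also have "\<dots> \<le> m n (\<lambda>x. translate_comb E a x * translate_comb E a x)"
          unfolding m_def
        proof (intro divide_right_mono sum_mono)
          fix x
          show "2 * \<delta> * translate_comb E a x + - \<delta>\<^sup>2 \<le> translate_comb E a x * translate_comb E a x"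
            using zero_le_power2[of "translate_comb E a x - \<delta>"] by (simp add: power2_eq_square algebra_simps)
        qed simp
        finally show "\<delta>\<^sup>2 + 2 * \<delta> * d n \<le> m n (\<lambda>x. translate_comb E a x * translate_comb E a x)" .
      qed
      ultimately show ?thesis using tendsto_le[OF F'(1) lim] by fastforce
    qed
  qed
  moreover have "\<exists>x\<in>E. x + v \<in> E" if pos: "ip 1 (?\<delta> v) > 0" for v
  proof (rule ccontr)
    assume no: "\<not> ?thesis"
    then have "indicat_real E x * indicat_real E (x + v) = 0" for x by (auto simp: indicator_def)
    then have "translate_comb E 1 x * translate_comb E (?\<delta> v) x = 0" for x
      by (simp only: translate_comb_one translate_comb_single mult_1)
    then have "((\<lambda>n. 0) \<longlongrightarrow> ip 1 (?\<delta> v)) F'"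
      using lim[of 1 "?\<delta> v"] by (simp only: m_def sum.neutral_const div_0)
    then have "ip 1 (?\<delta> v) = 0" using uniq tendsto_const by blast
    with pos show False by simp
  qed
  ultimately show ?thesis by blast
qed

subsection \<open>Companion matrices and conjugation by transvections\<close>

text \<open>The free subdiagonal entry \<open>s\<close> keeps the family closed under multiplication
  by scalars.\<close>

definition companion_matrix :: "nat \<Rightarrow> int \<Rightarrow> (nat \<Rightarrow> int) \<Rightarrow> int mat" where
  "companion_matrix d s b = mat d d (\<lambda>(i, j). if j = d - 1 then b i else if i = Suc j then s else 0)"

lemma companion_matrix_carrier [simp]: "companion_matrix d s b \<in> carrier_mat d d"
  by (simp add: companion_matrix_def)

lemma char_poly_matrix_companion:
  "char_poly_matrix (companion_matrix d s b) = mat d d (\<lambda>(i, j).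
     (if i = j then [:0, 1:] else 0) - (if j = d - 1 then [:b i:] else if i = Suc j then [:s:] else 0))"
  by (rule eq_matI) (auto simp: char_poly_matrix_def companion_matrix_def)

text \<open>In the first row only the two end entries survive: the first leads to the smaller
  companion matrix, the last to a triangular minor with diagonal \<open>- s\<close>, whose sign
  cancels that of the cofactor.\<close>

lemma char_poly_companion_matrix:
  "char_poly (companion_matrix (Suc n) s b) = monom 1 (Suc n) - (\<Sum>i\<le>n. monom (b i * s ^ (n - i)) i)"
proof (induction n arbitrary: b)
  case 0
  show ?case
    unfolding char_poly_def char_poly_matrix_companion
    by (subst det_single) (auto simp: monom_altdef)
next
  case (Suc n)
  let ?M = "\<lambda>d b. char_poly_matrix (companion_matrix d s b)"
  let ?A = "?M (Suc (Suc n)) b"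
  have A: "?A \<in> carrier_mat (Suc (Suc n)) (Suc (Suc n))" by simp
  have d0: "mat_delete ?A 0 0 = ?M (Suc n) (\<lambda>i. b (Suc i))"
    unfolding char_poly_matrix_companion mat_delete_def by (rule eq_matI) auto
  have dn: "det (mat_delete ?A 0 (Suc n)) = [:- s:] ^ Suc n"
  proof -
    let ?D = "mat_delete ?A 0 (Suc n)"
    have c: "?D \<in> carrier_mat (Suc n) (Suc n)" using mat_delete_carrier[OF A] by simp
    have "upper_triangular ?D"
      unfolding upper_triangular_def char_poly_matrix_companion mat_delete_def by auto
    then have "det ?D = prod_list (diag_mat ?D)" by (rule det_upper_triangular[OF _ c])
    also have "diag_mat ?D = map (\<lambda>i. [:- s:]) [0..<Suc n]"
      using c unfolding diag_mat_def by (auto simp: char_poly_matrix_companion mat_delete_def)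
    also have "prod_list \<dots> = [:- s:] ^ Suc n"
      by (simp only: map_replicate_const length_upt prod_list_replicate diff_zero)
    finally show ?thesis .
  qed
  have "char_poly (companion_matrix (Suc (Suc n)) s b) = (\<Sum>j<Suc (Suc n). ?A $$ (0, j) * cofactor ?A 0 j)"
    unfolding char_poly_def by (rule laplace_expansion_row[OF A]) simp
  also have "\<dots> = (\<Sum>j\<in>{0, Suc n}. ?A $$ (0, j) * cofactor ?A 0 j)"
    by (rule sum.mono_neutral_right) (auto simp: char_poly_matrix_companion)
  also have "\<dots> = [:0, 1:] * det (?M (Suc n) (\<lambda>i. b (Suc i))) + - [:b 0:] * ((-1) ^ Suc n * [:- s:] ^ Suc n)"
    by (simp add: cofactor_def d0 dn) (simp add: char_poly_matrix_companion)
  also have "(-1) ^ Suc n * [:- s:] ^ Suc n = [:s:] ^ Suc n"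
    by (simp only: power_mult_distrib[symmetric]) simp
  also have "[:s:] ^ Suc n = [:s ^ Suc n:]"
    by (simp only: monom_0[symmetric] monom_power mult_0)
  also have "[:0, 1:] * det (?M (Suc n) (\<lambda>i. b (Suc i)))
      = monom 1 (Suc (Suc n)) - (\<Sum>i\<le>n. monom (b (Suc i) * s ^ (n - i)) (Suc i))"
  proof -
    have m1: "[:0, 1:] = monom (1::int) 1" by (simp add: monom_altdef)
    show ?thesis
      unfolding Suc.IH[unfolded char_poly_def] m1
      by (simp only: right_diff_distrib sum_distrib_left mult_monom mult_1 plus_1_eq_Suc)
  qed
  finally have "char_poly (companion_matrix (Suc (Suc n)) s b)
      = monom 1 (Suc (Suc n)) - ((\<Sum>i\<le>n. monom (b (Suc i) * s ^ (n - i)) (Suc i)) + monom (b 0 * s ^ Suc n) 0)"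
    by (simp add: monom_0)
  also have "(\<Sum>i\<le>n. monom (b (Suc i) * s ^ (n - i)) (Suc i)) + monom (b 0 * s ^ Suc n) 0
      = (\<Sum>i\<le>Suc n. monom (b i * s ^ (Suc n - i)) i)"
    by (subst sum.atMost_Suc_shift) simp
  finally show ?case .
qed

text \<open>At \<open>X ^ i\<close> the last column supplies one factor \<open>k\<close> and the
  subdiagonal supplies \<open>d - 1 - i\<close> more.\<close>

lemma char_poly_trace_zero_companion:
  assumes "d \<ge> 2" "a (d - 1) = 0"
  shows "char_poly (companion_matrix d k (\<lambda>i. - k * a i))
    = monom 1 d + (\<Sum>j\<in>{2..d}. monom (k ^ j * a (d - j)) (d - j))"
proof -
  obtain n where n: "d = Suc (Suc n)" using assms by (metis Suc_le_D numeral_2_eq_2 le_Suc_ex add_Suc)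
  have "char_poly (companion_matrix d k (\<lambda>i. - k * a i))
      = monom 1 d - (\<Sum>i\<le>Suc n. monom (- k * a i * k ^ (Suc n - i)) i)"
    unfolding n by (rule char_poly_companion_matrix)
  also have "(\<Sum>i\<le>Suc n. monom (- k * a i * k ^ (Suc n - i)) i) = (\<Sum>i\<le>n. monom (- k * a i * k ^ (Suc n - i)) i)"
    using assms n by simp
  also have "\<dots> = - (\<Sum>i\<le>n. monom (k ^ (d - i) * a i) i)"
    unfolding sum_negf[symmetric]
    by (rule sum.cong[OF refl]) (auto simp: n Suc_diff_le minus_monom ac_simps)
  also have "(\<Sum>i\<le>n. monom (k ^ (d - i) * a i) i) = (\<Sum>j\<in>{2..d}. monom (k ^ j * a (d - j)) (d - j))"
    by (rule sum.reindex_bij_witness[of _ "\<lambda>j. d - j" "\<lambda>i. d - i"]) (auto simp: n)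
  finally show ?thesis by simp
qed

section \<open>Conjugation by transvections\<close>

lemma mat_mult_index:
  assumes "A \<in> carrier_mat d d" "B \<in> carrier_mat d d" "i < d" "j < d"
  shows "(A * B) $$ (i, j) = (\<Sum>l<d. A $$ (i, l) * B $$ (l, j))"
  using assms by (simp add: scalar_prod_def lessThan_atLeast0)

definition transvection :: "nat \<Rightarrow> (nat \<Rightarrow> int) \<Rightarrow> (nat \<Rightarrow> int) \<Rightarrow> int \<Rightarrow> int mat" where
  "transvection d u v t = mat d d (\<lambda>(i, j). (if i = j then 1 else 0) + t * (u i * v j))"

lemma transvection_carrier [simp]: "transvection d u v t \<in> carrier_mat d d"
  by (simp add: transvection_def)

lemma mult_transvection_index:
  assumes M: "M \<in> carrier_mat d d" and i: "i < d" "j < d"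
  shows "(M * transvection d u v t) $$ (i, j) = M $$ (i, j) + t * (\<Sum>l<d. M $$ (i, l) * u l) * v j"
    and "(transvection d u v t * M) $$ (i, j) = M $$ (i, j) + t * u i * (\<Sum>l<d. v l * M $$ (l, j))"
proof -
  show "(M * transvection d u v t) $$ (i, j) = M $$ (i, j) + t * (\<Sum>l<d. M $$ (i, l) * u l) * v j"
    unfolding mat_mult_index[OF M transvection_carrier i]
    using i by (simp add: transvection_def distrib_left sum.distrib sum_distrib_left sum_distrib_right
        if_distrib[of "\<lambda>x. _ * x"] ac_simps cong: if_cong)
  show "(transvection d u v t * M) $$ (i, j) = M $$ (i, j) + t * u i * (\<Sum>l<d. v l * M $$ (l, j))"
    unfolding mat_mult_index[OF transvection_carrier M i]
    using i by (simp add: transvection_def distrib_left sum.distrib sum_distrib_left sum_distrib_right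
        if_distrib[of "\<lambda>x. _ * x"] ac_simps cong: if_cong)
qed

lemma transvection_inverse:
  assumes "(\<Sum>l<d. v l * u l) = 0"
  shows "transvection d u v t * transvection d u v (- t) = 1\<^sub>m d"
proof (rule eq_matI)
  fix i j assume ij: "i < dim_row (1\<^sub>m d)" "j < dim_col (1\<^sub>m d)"
  have "(\<Sum>l<d. transvection d u v t $$ (i, l) * u l) = u i + t * u i * (\<Sum>l<d. v l * u l)"
    using ij by (simp add: transvection_def distrib_left sum.distrib sum_distrib_left sum_distrib_right
        if_distrib[of "\<lambda>x. _ * x"] ac_simps cong: if_cong)
  then show "(transvection d u v t * transvection d u v (- t)) $$ (i, j) = 1\<^sub>m d $$ (i, j)"
    using ij assms by (subst mult_transvection_index(1)) (auto simp: transvection_def)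
qed (auto simp: transvection_def)

text \<open>For \<open>N = u v^T\<close> with square zero, \<open>1 + t N\<close> has inverse
  \<open>1 - t N\<close>, and \<open>N M N\<close> is the scalar \<open>v^T M u\<close> times
  \<open>N\<close>; this makes the quadratic term a multiple of \<open>N\<close>.\<close>

lemma transvection_conjugate:
  fixes t :: int
  assumes M: "M \<in> carrier_mat d d" and vu: "(\<Sum>l<d. v l * u l) = 0"
  defines "P \<equiv> transvection d u v t * M * transvection d u v (- t)"
  shows "P \<in> carrier_mat d d" and "char_poly P = char_poly M"
    and "i < d \<Longrightarrow> j < d \<Longrightarrow> P $$ (i, j) = M $$ (i, j)
      + t * (u i * (\<Sum>l<d. v l * M $$ (l, j)) - (\<Sum>l<d. M $$ (i, l) * u l) * v j)
      - t\<^sup>2 * ((\<Sum>l<d. \<Sum>m<d. v l * M $$ (l, m) * u m) * (u i * v j))"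
proof -
  show P: "P \<in> carrier_mat d d" unfolding P_def using M by (auto simp: transvection_def)
  have inv': "transvection d u v (- t) * transvection d u v t = 1\<^sub>m d"
    using transvection_inverse[OF vu, of "- t"] by simp
  have "similar_mat P M"
    by (rule similar_matI[of _ _ "transvection d u v t" "transvection d u v (- t)" d])
      (use M P transvection_inverse[OF vu, of t] inv' P_def in auto)
  then show "char_poly P = char_poly M" by (rule char_poly_similar)
  assume ij: "i < d" "j < d"
  let ?Q = "transvection d u v t * M"
  have Q: "?Q \<in> carrier_mat d d" using M by (auto simp: transvection_def)
  have "(\<Sum>m<d. ?Q $$ (i, m) * u m) = (\<Sum>m<d. M $$ (i, m) * u m) + t * u i * (\<Sum>m<d. \<Sum>l<d. v l * M $$ (l, m) * u m)"
    using ij by (simp add: mult_transvection_index(2)[OF M] distrib_left sum.distrib sum_distrib_left sum_distrib_right ac_simps)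
  also have "(\<Sum>m<d. \<Sum>l<d. v l * M $$ (l, m) * u m) = (\<Sum>l<d. \<Sum>m<d. v l * M $$ (l, m) * u m)"
    by (rule sum.swap)
  finally have Qu: "(\<Sum>m<d. ?Q $$ (i, m) * u m) = (\<Sum>m<d. M $$ (i, m) * u m)
      + t * u i * (\<Sum>l<d. \<Sum>m<d. v l * M $$ (l, m) * u m)" .
  show "P $$ (i, j) = M $$ (i, j)
      + t * (u i * (\<Sum>l<d. v l * M $$ (l, j)) - (\<Sum>l<d. M $$ (i, l) * u l) * v j)
      - t\<^sup>2 * ((\<Sum>l<d. \<Sum>m<d. v l * M $$ (l, m) * u m) * (u i * v j))"
    unfolding P_def mult_transvection_index(1)[OF Q ij] Qu mult_transvection_index(2)[OF M ij]
    by (simp add: algebra_simps power2_eq_square)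
qed

text \<open>Lagrange interpolation with cleared denominators: up to the factor \<open>W\<close>,
  which depends only on the nodes, every coefficient functional is an integer combination of
  evaluations.\<close>

lemma integral_interpolation:
  fixes X :: "int set"
  assumes fin: "finite X"
  shows "\<exists>W\<ge>1. \<forall>e. \<exists>z. \<forall>p. degree p < card X \<longrightarrow> W * coeff p e = (\<Sum>x\<in>X. z x * poly p x)"
proof -
  define ell where "ell x = (\<Prod>y\<in>X - {x}. [:- y, 1:])" for x
  define w where "w x = poly (ell x) x" for x
  have w: "w x \<noteq> 0" for x
    using fin unfolding w_def ell_def poly_prod by (subst prod_zero_iff) auto
  have off: "poly (ell x) y = 0" if "y \<in> X" "y \<noteq> x" for x y
    using fin that unfolding ell_def poly_prod by (subst prod_zero_iff) auto
  have deg: "degree (ell x) < card X" if "x \<in> X" for x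
  proof -
    have "degree (ell x) \<le> (\<Sum>y\<in>X - {x}. 1)"
      unfolding ell_def by (rule order_trans[OF degree_prod_sum_le]) (use fin in auto)
    also have "\<dots> < card X" using card_Diff1_less[OF fin that] by simp
    finally show ?thesis .
  qed
  \<comment> \<open>Squares make \<open>W\<close> positive whatever the signs of the
    \<open>w x\<close>.\<close>
  define W where "W = (\<Prod>x\<in>X. (w x)\<^sup>2)"
  have "W > 0" unfolding W_def using w by (intro prod_pos) auto
  define co where "co x = (\<Prod>y\<in>X - {x}. (w y)\<^sup>2) * w x" for x
  have co: "co x * w x = W" if "x \<in> X" for x
    unfolding co_def W_def using prod.remove[OF fin that, of "\<lambda>y. (w y)\<^sup>2"]
    by (simp add: power2_eq_square ac_simps)
  have eq: "Polynomial.smult W p = (\<Sum>x\<in>X. Polynomial.smult (poly p x * co x) (ell x))" if p: "degree p < card X" for p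
  proof (rule poly_eqI_degree[of X])
    fix y assume y: "y \<in> X"
    have "poly (\<Sum>x\<in>X. Polynomial.smult (poly p x * co x) (ell x)) y = (\<Sum>x\<in>X. poly p x * co x * poly (ell x) y)"
      by (simp add: poly_sum)
    also have "\<dots> = (\<Sum>x\<in>{y}. poly p x * co x * poly (ell x) y)"
      using fin y off by (intro sum.mono_neutral_right) auto
    also have "\<dots> = W * poly p y" using co[OF y] by (simp add: w_def ac_simps)
    finally show "poly (Polynomial.smult W p) y = poly (\<Sum>x\<in>X. Polynomial.smult (poly p x * co x) (ell x)) y" by simp
  next
    show "degree (Polynomial.smult W p) < card X" using p by (meson degree_smult_le le_less_trans)
    have "degree (\<Sum>x\<in>X. Polynomial.smult (poly p x * co x) (ell x)) \<le> card X - 1"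
      by (rule degree_sum_le[OF fin]) (use deg degree_smult_le in \<open>fastforce intro: order_trans\<close>)
    then show "degree (\<Sum>x\<in>X. Polynomial.smult (poly p x * co x) (ell x)) < card X" using p by linarith
  qed
  have "W * coeff p e = (\<Sum>x\<in>X. (co x * coeff (ell x) e) * poly p x)" if "degree p < card X" for p e
    using arg_cong[OF eq[OF that], of "\<lambda>q. coeff q e"] by (simp add: coeff_sum ac_simps)
  then show ?thesis using \<open>W > 0\<close> by (intro exI[of _ W]) (auto intro: exI)
qed

subsection \<open>A spanning family of rank one nilpotents\<close>

lemma sum_fun_apply: "(\<Sum>i\<in>I. f i) x = (\<Sum>i\<in>I. f i x)" for f :: "'i \<Rightarrow> 'b \<Rightarrow> int"
  by (induction I rule: infinite_finite_induct) auto

lemma of_nat_fun_apply: "(of_nat n :: 'b \<Rightarrow> int) x = int n"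
  by (induction n) auto

lemma of_int_fun_apply: "(of_int n :: 'b \<Rightarrow> int) x = n"
  by (cases n rule: int_cases2) (auto simp: of_nat_fun_apply)

lemmas fun_apply = sum_fun_apply of_nat_fun_apply of_int_fun_apply

text \<open>Matrices are carried as functions vanishing outside the \<open>d\<close> by
  \<open>d\<close> square: under pointwise operations these live in a commutative ring, as
  \<open>shift_form\<close> asks of its group, and \<open>of_int\<close> becomes a constant
  function.\<close>

definition boxed :: "nat \<Rightarrow> (nat \<Rightarrow> nat \<Rightarrow> int) \<Rightarrow> nat \<times> nat \<Rightarrow> int" where
  "boxed d f = (\<lambda>(i, j). if i < d \<and> j < d then f i j else 0)"

definition trace_zero :: "nat \<Rightarrow> (nat \<times> nat \<Rightarrow> int) set" where
  "trace_zero d = {g. (\<forall>i j. \<not> (i < d \<and> j < d) \<longrightarrow> g (i, j) = 0) \<and> (\<Sum>i<d. g (i, i)) = 0}"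

lemma boxed_trace_zero: "(\<Sum>i<d. f i i) = 0 \<Longrightarrow> boxed d f \<in> trace_zero d"
  by (auto simp: boxed_def trace_zero_def)

text \<open>The entry at 0 is chosen to make the row orthogonal to the column \<open>x ^ l\<close>,
  so that their product squares to zero.\<close>

definition moment_row :: "nat \<Rightarrow> int \<Rightarrow> nat \<Rightarrow> int" where
  "moment_row d x b = (if b = 0 then \<Sum>b'\<in>{1..<d}. x ^ (2 * d * b' + b') else - (x ^ (2 * d * b)))"

text \<open>The matrix of the rank one nilpotent with column \<open>x ^ a\<close> and row \<open>moment_row d x b\<close>. The exponents
  are spread out so that the coefficients of its powers of \<open>x\<close> span all trace zero matrices.\<close>

definition moment_nilpotent :: "nat \<Rightarrow> int \<Rightarrow> nat \<times> nat \<Rightarrow> int" where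
  "moment_nilpotent d x = boxed d (\<lambda>a b. x ^ a * moment_row d x b)"

definition moment_poly :: "nat \<Rightarrow> nat \<Rightarrow> nat \<Rightarrow> int poly" where
  "moment_poly d a b = (if b = 0 then \<Sum>b'\<in>{1..<d}. monom 1 (a + (2 * d * b' + b')) else - monom 1 (a + 2 * d * b))"

lemma poly_moment_poly: "poly (moment_poly d a b) x = x ^ a * moment_row d x b"
  by (simp add: moment_poly_def moment_row_def poly_sum poly_monom power_add sum_distrib_left)

lemma moment_row_orthogonal:
  assumes "d > 0"
  shows "(\<Sum>l<d. moment_row d x l * x ^ l) = 0"
proof -
  have split: "{..<d} = insert 0 {1..<d}" using assms by auto
  show ?thesis
    unfolding split by (simp add: moment_row_def power_add sum_negf[symmetric] flip: sum.distrib)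
qed

text \<open>The bound is the number of nodes that interpolation will require.\<close>

lemma degree_moment_poly:
  assumes "a < d" "b < d"
  shows "degree (moment_poly d a b) < 2 * d * d"
proof -
  have bound: "a + (2 * d * b' + b') \<le> 2 * d * d - 2" if b': "b' < d" for b'
  proof -
    have "2 * d * b' \<le> 2 * d * (d - 1)" using b' by (intro mult_left_mono) auto
    then have "2 * d * b' \<le> 2 * d * d - 2 * d" by (simp add: diff_mult_distrib2)
    moreover have "2 * d * 1 \<le> 2 * d * d" using b' by (intro mult_left_mono) auto
    ultimately show ?thesis using assms(1) b' by linarith
  qed
  have "degree (moment_poly d a b) \<le> 2 * d * d - 2"
  proof (cases "b = 0")
    case True
    then show ?thesis unfolding moment_poly_def
      by (auto intro!: degree_sum_le order_trans[OF degree_monom_le] bound)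
  next
    case False
    then show ?thesis unfolding moment_poly_def
      using bound[of b] assms by (auto intro!: order_trans[OF degree_monom_le])
  qed
  moreover have "d * d \<ge> 1" using assms by (cases d) auto
  ultimately show ?thesis by linarith
qed

text \<open>Exponents are read in base \<open>2 * d\<close>: the quotient identifies the column
  \<open>b0\<close>, and the remainder the row, since \<open>a + b' < 2 * d\<close> excludes
  carries.\<close>

lemma coeff_moment_poly:
  assumes "a < d" "b < d" "1 \<le> b0" "b0 < d" "f < 2 * d"
  shows "coeff (moment_poly d a b) (2 * d * b0 + f)
    = (if b = 0 then if f = a + b0 then 1 else 0 else if b = b0 \<and> a = f then - 1 else 0)"
proof -
  have uniq: "2 * d * b' + r = 2 * d * b0 + f \<longleftrightarrow> b' = b0 \<and> r = f" if "r < 2 * d" for b' r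
  proof
    assume eq: "2 * d * b' + r = 2 * d * b0 + f"
    have "(2 * d * b' + r) div (2 * d) = b'" "(2 * d * b0 + f) div (2 * d) = b0"
      using that assms by (simp_all add: div_mult_self2)
    then show "b' = b0 \<and> r = f" using eq by auto
  qed auto
  show ?thesis
  proof (cases "b = 0")
    case True
    have "coeff (moment_poly d a b) (2 * d * b0 + f)
        = (\<Sum>b'\<in>{1..<d}. if 2 * d * b' + (a + b') = 2 * d * b0 + f then 1 else 0)"
      using True by (simp add: moment_poly_def coeff_sum ac_simps)
    also have "\<dots> = (\<Sum>b'\<in>{1..<d}. if b' = b0 then (if f = a + b0 then 1 else 0) else 0)"
      using assms by (intro sum.cong refl) (auto simp: uniq)
    finally show ?thesis using True assms by simp
  next
    case False
    then show ?thesis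
      using assms uniq[of a b] by (auto simp: moment_poly_def ac_simps)
  qed
qed

section \<open>Integer span of the nilpotents via matrix units\<close>

definition mat_unit :: "nat \<Rightarrow> nat \<Rightarrow> nat \<times> nat \<Rightarrow> int" where
  "mat_unit a b = (\<lambda>p. if p = (a, b) then 1 else 0)"

text \<open>The corrections by \<open>mat_unit 0 0\<close> on the diagonal add up to the trace,
  which is zero.\<close>

lemma trace_zero_expansion:
  assumes "g \<in> trace_zero d"
  shows "g = (\<Sum>a<d. \<Sum>b<d. of_int (g (a, b)) * (mat_unit a b - (if a = b then mat_unit 0 0 else 0)))"
proof
  fix p :: "nat \<times> nat"
  obtain i j where p: "p = (i, j)" by force
  have "(\<Sum>a<d. \<Sum>b<d. of_int (g (a, b)) * (mat_unit a b - (if a = b then mat_unit 0 0 else 0))) p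
      = (\<Sum>a<d. \<Sum>b<d. g (a, b) * mat_unit a b p) - (\<Sum>a<d. \<Sum>b<d. if a = b then g (a, b) * mat_unit 0 0 p else 0)"
    unfolding sum_subtractf[symmetric]
    by (auto simp: fun_apply right_diff_distrib intro!: sum.cong)
  also have "(\<Sum>a<d. \<Sum>b<d. if a = b then g (a, b) * mat_unit 0 0 p else 0) = (\<Sum>a<d. g (a, a)) * mat_unit 0 0 p"
    by (simp add: sum_distrib_right)
  also have "\<dots> = 0" using assms by (simp add: trace_zero_def)
  also have "(\<Sum>a<d. \<Sum>b<d. g (a, b) * mat_unit a b p) = (\<Sum>a<d. if a = i then (\<Sum>b<d. if b = j then g (a, b) else 0) else 0)"
    by (intro sum.cong refl)
      (auto simp: mat_unit_def p if_distrib[of "\<lambda>x. _ * x"] cong: if_cong)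
  also have "\<dots> = g p" using assms by (auto simp: p trace_zero_def)
  finally show "g p = (\<Sum>a<d. \<Sum>b<d. of_int (g (a, b)) * (mat_unit a b - (if a = b then mat_unit 0 0 else 0))) p"
    by (simp only: diff_0_right)
qed

text \<open>Entrywise the nilpotents are values of polynomials in \<open>x\<close>, so interpolation
  puts their coefficient matrices into the span up to the factor \<open>W\<close>. Those at
  exponents \<open>2 * d * b + f\<close> are differences of two matrix units, or single units when
  one falls outside the square, and generate all trace zero matrices.\<close>

lemma moment_nilpotents_span:
  assumes d: "d \<ge> 2" and fin: "finite X" and card: "card X \<ge> 2 * d * d"
  shows "\<exists>W\<ge>1. \<forall>g\<in>trace_zero d. \<exists>z. of_int W * g = (\<Sum>x\<in>X. of_int (z x) * moment_nilpotent d x)"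
proof -
  obtain W where W: "W \<ge> 1"
    "\<And>e. \<exists>z. \<forall>p. degree p < card X \<longrightarrow> W * coeff p e = (\<Sum>x\<in>X. z x * poly p x)"
    using integral_interpolation[OF fin] by blast
  \<comment> \<open>Since \<open>W\<close> is the same for every exponent, this set is closed under
    sums and integer multiples without new denominators.\<close>
  define Sp where "Sp = {g. \<exists>z. of_int W * g = (\<Sum>x\<in>X. of_int (z x) * moment_nilpotent d x)}"
  have Sp_add: "g + g' \<in> Sp" if "g \<in> Sp" "g' \<in> Sp" for g g'
  proof -
    obtain z z' where "of_int W * g = (\<Sum>x\<in>X. of_int (z x) * moment_nilpotent d x)"
      "of_int W * g' = (\<Sum>x\<in>X. of_int (z' x) * moment_nilpotent d x)" using \<open>g \<in> Sp\<close> \<open>g' \<in> Sp\<close> unfolding Sp_def by blast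
    then have "of_int W * (g + g') = (\<Sum>x\<in>X. of_int (z x + z' x) * moment_nilpotent d x)"
      by (simp only: distrib_left of_int_add distrib_right sum.distrib)
    then show ?thesis unfolding Sp_def by (intro CollectI exI[of _ "\<lambda>x. z x + z' x"])
  qed
  have Sp_mult: "of_int n * g \<in> Sp" if "g \<in> Sp" for g n
  proof -
    obtain z where "of_int W * g = (\<Sum>x\<in>X. of_int (z x) * moment_nilpotent d x)"
      using \<open>g \<in> Sp\<close> unfolding Sp_def by blast
    then have "of_int W * (of_int n * g) = (\<Sum>x\<in>X. of_int (n * z x) * moment_nilpotent d x)"
      by (simp only: mult.left_commute[of "of_int W"] of_int_mult mult.assoc sum_distrib_left)
    then show ?thesis unfolding Sp_def by (intro CollectI exI[of _ "\<lambda>x. n * z x"])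
  qed
  have Sp_0: "0 \<in> Sp" using Sp_mult[of _ 0] unfolding Sp_def by (auto intro!: exI[of _ "\<lambda>_. 0"])
  have Sp_minus: "- g \<in> Sp" if "g \<in> Sp" for g using Sp_mult[OF that, of "- 1"] by simp
  have Sp_sum: "(\<Sum>i\<in>I. f i) \<in> Sp" if "\<And>i. i \<in> I \<Longrightarrow> f i \<in> Sp" for I and f :: "nat \<Rightarrow> nat \<times> nat \<Rightarrow> int"
    using that
  proof (induction I rule: infinite_finite_induct)
    case (infinite A)
    then show ?case by (simp only: sum.infinite Sp_0 not_False_eq_True)
  next
    case empty
    show ?case by (simp only: sum.empty Sp_0)
  next
    case (insert x F)
    then have "f x + sum f F \<in> Sp" by (intro Sp_add) auto
    then show ?case by (simp only: sum.insert[OF insert(1,2)])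
  qed
  have coeffs: "boxed d (\<lambda>a b. coeff (moment_poly d a b) e) \<in> Sp" for e
  proof -
    obtain z where z: "\<And>p. degree p < card X \<Longrightarrow> W * coeff p e = (\<Sum>x\<in>X. z x * poly p x)"
      using W(2) by blast
    have "of_int W * boxed d (\<lambda>a b. coeff (moment_poly d a b) e) = (\<Sum>x\<in>X. of_int (z x) * moment_nilpotent d x)"
    proof
      fix p :: "nat \<times> nat"
      obtain a b where p: "p = (a, b)" by force
      show "(of_int W * boxed d (\<lambda>a b. coeff (moment_poly d a b) e)) p = (\<Sum>x\<in>X. of_int (z x) * moment_nilpotent d x) p"
      proof (cases "a < d \<and> b < d")
        case True
        then have "degree (moment_poly d a b) < card X" using degree_moment_poly[of a d b] card by simp
        from z[OF this] show ?thesis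
          using True by (simp add: p fun_apply boxed_def moment_nilpotent_def poly_moment_poly)
      next
        case False
        then show ?thesis by (auto simp: p fun_apply boxed_def moment_nilpotent_def)
      qed
    qed
    then show ?thesis unfolding Sp_def by blast
  qed
  have rel: "(if b \<le> f \<and> f < b + d then mat_unit (f - b) 0 else 0) - (if f < d then mat_unit f b else 0) \<in> Sp"
    if b: "1 \<le> b" "b < d" and f: "f < 2 * d" for b f
  proof -
    have "boxed d (\<lambda>a b'. coeff (moment_poly d a b') (2 * d * b + f))
        = (if b \<le> f \<and> f < b + d then mat_unit (f - b) 0 else 0) - (if f < d then mat_unit f b else 0)"
    proof
      fix p :: "nat \<times> nat"
      obtain a b' where p: "p = (a, b')" by force
      show "boxed d (\<lambda>a b'. coeff (moment_poly d a b') (2 * d * b + f)) p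
        = ((if b \<le> f \<and> f < b + d then mat_unit (f - b) 0 else 0) - (if f < d then mat_unit f b else 0)) p"
      proof (cases "a < d \<and> b' < d")
        case True
        then show ?thesis using b f
          by (auto simp: p boxed_def coeff_moment_poly[OF _ _ b f] mat_unit_def)
      next
        case False
        then show ?thesis using b f by (auto simp: p boxed_def mat_unit_def)
      qed
    qed
    then show ?thesis using coeffs[of "2 * d * b + f"] by simp
  qed
  \<comment> \<open>For \<open>b = d - 1\<close> and \<open>f = d - 1 + a\<close> the unit
    \<open>mat_unit f b\<close> falls outside the square and the other one remains alone.\<close>
  have col0: "mat_unit a 0 \<in> Sp" if "1 \<le> a" "a < d" for a
  proof -
    obtain e where "d = Suc e" using d by (cases d) auto
    then show ?thesis using rel[of e "e + a"] that by simp
  qed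
  have diag: "mat_unit 0 0 - mat_unit b b \<in> Sp" if "1 \<le> b" "b < d" for b
    using rel[of b b] that by simp
  have offdiag: "mat_unit a b \<in> Sp" if ab: "1 \<le> b" "b < d" "a < d" "a \<noteq> b" for a b
  proof (cases "a < b")
    case True
    then show ?thesis using rel[of b a] ab Sp_minus[of "- mat_unit a b"] by simp
  next
    case False
    then have "mat_unit (a - b) 0 - mat_unit a b \<in> Sp" "mat_unit (a - b) 0 \<in> Sp"
      using rel[of b a] ab col0[of "a - b"] by auto
    then show ?thesis using Sp_add[OF _ Sp_minus, of "mat_unit (a - b) 0" "mat_unit (a - b) 0 - mat_unit a b"]
      by simp
  qed
  have "mat_unit a b - (if a = b then mat_unit 0 0 else 0) \<in> Sp" if "a < d" "b < d" for a b
  proof -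
    consider "a = b" "b = 0" | "a = b" "b \<ge> 1" | "a \<noteq> b" "b = 0" | "a \<noteq> b" "b \<ge> 1" by linarith
    then show ?thesis
    proof cases
      case 2
      then show ?thesis using Sp_minus[OF diag[of b]] that by simp
    qed (use that col0 offdiag Sp_0 in auto)
  qed
  then have "g \<in> Sp" if "g \<in> trace_zero d" for g
    by (subst trace_zero_expansion[OF that]) (intro Sp_sum Sp_mult, auto)
  then show ?thesis using W(1) unfolding Sp_def by blast
qed

definition moment_pairing :: "nat \<Rightarrow> int mat \<Rightarrow> int \<Rightarrow> int" where
  "moment_pairing d A x = (\<Sum>l<d. \<Sum>m<d. moment_row d x l * A $$ (l, m) * x ^ m)"

text \<open>The pairing is the trace of \<open>A\<close> times the nilpotent. If it vanished at
  \<open>2 * d * d\<close> values of \<open>x\<close>, spanning would make the trace against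
  \<open>A\<close> vanish at \<open>mat_unit 0 1\<close>, where it equals the entry
  \<open>A $$ (1, 0)\<close>.\<close>

lemma infinite_nonzero_pairing:
  assumes d: "d \<ge> 2" and A: "A $$ (1, 0) \<noteq> 0"
  shows "infinite {x::nat. moment_pairing d A (int x) \<noteq> 0}"
proof
  assume "finite {x::nat. moment_pairing d A (int x) \<noteq> 0}"
  then have "infinite (UNIV - {x::nat. moment_pairing d A (int x) \<noteq> 0})" by (rule Diff_infinite_finite) simp
  then obtain X0 where X0: "finite X0" "card X0 = 2 * d * d"
    "X0 \<subseteq> UNIV - {x::nat. moment_pairing d A (int x) \<noteq> 0}"
    using infinite_arbitrarily_large by blast
  define X where "X = int ` X0"
  have X: "finite X" "card X = 2 * d * d" "\<And>x. x \<in> X \<Longrightarrow> moment_pairing d A x = 0"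
    using X0 by (auto simp: X_def card_image)
  define \<phi> where "\<phi> g = (\<Sum>l<d. \<Sum>m<d. A $$ (l, m) * g (m, l))" for g :: "nat \<times> nat \<Rightarrow> int"
  have \<phi>_mult: "\<phi> (of_int n * g) = n * \<phi> g" for n g
    by (simp add: \<phi>_def fun_apply sum_distrib_left ac_simps)
  have \<phi>_sum: "\<phi> (\<Sum>i\<in>I. f i) = (\<Sum>i\<in>I. \<phi> (f i))" for I :: "int set" and f
    by (induction I rule: infinite_finite_induct) (simp_all add: \<phi>_def distrib_left sum.distrib)
  have \<phi>_nil: "\<phi> (moment_nilpotent d x) = moment_pairing d A x" for x
    by (simp add: \<phi>_def moment_nilpotent_def boxed_def moment_pairing_def ac_simps)
  have tz: "mat_unit 0 1 \<in> trace_zero d" using d by (auto simp: mat_unit_def trace_zero_def intro!: sum.neutral)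
  obtain W z where W: "W \<ge> 1" "of_int W * mat_unit 0 1 = (\<Sum>x\<in>X. of_int (z x) * moment_nilpotent d x)"
    using moment_nilpotents_span[OF d X(1)] X(2) tz by auto
  have "W * \<phi> (mat_unit 0 1) = 0"
    using arg_cong[OF W(2), of \<phi>] X(3) by (simp add: \<phi>_mult \<phi>_sum \<phi>_nil)
  moreover have "\<phi> (mat_unit 0 1) = A $$ (1, 0)"
  proof -
    have "\<phi> (mat_unit 0 1) = (\<Sum>l<d. if l = 1 then (\<Sum>m<d. if m = 0 then A $$ (l, m) else 0) else 0)"
      unfolding \<phi>_def by (intro sum.cong refl) (auto simp: mat_unit_def if_distrib[of "\<lambda>x. _ * x"] cong: if_cong)
    then show ?thesis using d by auto
  qed
  ultimately show False using A W(1) by simp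
qed

text \<open>The nodes run through the infinitely many \<open>x\<close> with nonzero pairing, so
  every leading coefficient is a nonzero multiple of its nilpotent. Conjugation is linear in the
  matrix, hence \<open>B\<close> and \<open>C\<close> do not depend on \<open>k\<close>.\<close>

lemma quadratic_conjugates:
  assumes d: "d \<ge> 2" and A: "A \<in> M0 d" and A10: "A $$ (1, 0) \<noteq> 0"
  shows "\<exists>B C r. (\<forall>i::nat. B i \<in> trace_zero d \<and> C i \<in> trace_zero d) \<and>
     (\<forall>I. finite I \<longrightarrow> card I = 2 ^ r \<longrightarrow>
        (\<exists>m::int. m \<ge> 1 \<and> (\<forall>g\<in>trace_zero d. \<exists>z. of_int m * g = (\<Sum>i\<in>I. of_int (z i) * C i)))) \<and>
     (\<forall>k i t. char_poly (mat d d (of_int k * (boxed d (\<lambda>a b. A $$ (a, b)) + of_nat t * B i + (of_nat t)\<^sup>2 * C i)))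
        = char_poly (k \<cdot>\<^sub>m A))"
proof -
  have Ac: "A \<in> carrier_mat d d" using A by (simp add: M0_def)
  define S where "S = {x::nat. moment_pairing d A (int x) \<noteq> 0}"
  have infS: "infinite S" unfolding S_def by (rule infinite_nonzero_pairing[OF d A10])
  define x where "x i = int (enumerate S i)" for i
  have inj: "inj x" unfolding x_def using infS
    by (intro injI) (metis enumerate_mono less_irrefl nat_neq_iff of_nat_eq_iff)
  define c where "c i = moment_pairing d A (x i)" for i
  have c: "c i \<noteq> 0" for i using enumerate_in_set[OF infS, of i] by (simp add: c_def x_def S_def)
  define u where "u i a = x i ^ a" for i and a :: nat
  define v where "v i = moment_row d (x i)" for i
  have vu: "(\<Sum>l<d. v i l * u i l) = 0" for i
    unfolding u_def v_def using d by (intro moment_row_orthogonal) auto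
  define B where "B i = boxed d (\<lambda>a b. u i a * (\<Sum>l<d. v i l * A $$ (l, b)) - (\<Sum>l<d. A $$ (a, l) * u i l) * v i b)" for i
  define C where "C i = of_int (- c i) * moment_nilpotent d (x i)" for i
  have B: "B i \<in> trace_zero d" for i
    unfolding B_def
  proof (rule boxed_trace_zero)
    have "(\<Sum>a<d. \<Sum>l<d. u i a * (v i l * A $$ (l, a))) = (\<Sum>l<d. \<Sum>a<d. u i a * (v i l * A $$ (l, a)))"
      by (rule sum.swap)
    then show "(\<Sum>a<d. u i a * (\<Sum>l<d. v i l * A $$ (l, a)) - (\<Sum>l<d. A $$ (a, l) * u i l) * v i a) = 0"
      by (simp add: sum_subtractf sum_distrib_left sum_distrib_right ac_simps)
  qed
  have C: "C i \<in> trace_zero d" for i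
  proof -
    have "C i = boxed d (\<lambda>a b. - c i * (u i a * v i b))"
      by (rule ext) (auto simp: C_def moment_nilpotent_def boxed_def fun_apply u_def v_def)
    moreover have "(\<Sum>a<d. - c i * (u i a * v i a)) = - c i * (\<Sum>a<d. v i a * u i a)"
      by (simp add: sum_distrib_left ac_simps)
    ultimately show ?thesis using vu[of i] by (simp add: boxed_trace_zero)
  qed
  \<comment> \<open>Any exponent with \<open>2 ^ r \<ge> 2 * d * d\<close> would do;
    \<open>r < 2 ^ r\<close> makes this one work.\<close>
  define r where "r = 2 * d * d"
  have span: "\<exists>m::int. m \<ge> 1 \<and> (\<forall>g\<in>trace_zero d. \<exists>z. of_int m * g = (\<Sum>i\<in>I. of_int (z i) * C i))"
    if I: "finite I" "card I = 2 ^ r" for I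
  proof -
    have injI: "inj_on x I" using inj by (rule inj_on_subset) simp
    have "card (x ` I) \<ge> 2 * d * d"
      using I(2) less_exp[of r] by (simp add: card_image[OF injI] r_def)
    from moment_nilpotents_span[OF d finite_imageI[OF I(1)] this] obtain W
      where W: "W \<ge> 1" "\<And>g. g \<in> trace_zero d \<Longrightarrow> \<exists>z. of_int W * g = (\<Sum>y\<in>x ` I. of_int (z y) * moment_nilpotent d y)"
      by blast
    \<comment> \<open>A positive multiple of every \<open>c i\<close>, which absorbs the division by
      \<open>- c i\<close> when passing from nilpotents to the \<open>C i\<close>.\<close>
    define pr where "pr = (\<Prod>i\<in>I. (c i)\<^sup>2)"
    have "pr > 0" unfolding pr_def using c by (intro prod_pos) auto
    have "\<exists>z. of_int (W * pr) * g = (\<Sum>i\<in>I. of_int (z i) * C i)" if g: "g \<in> trace_zero d" for g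
    proof -
      obtain z where "of_int W * g = (\<Sum>y\<in>x ` I. of_int (z y) * moment_nilpotent d y)" using W(2)[OF g] by blast
      then have z: "of_int W * g = (\<Sum>i\<in>I. of_int (z (x i)) * moment_nilpotent d (x i))"
        by (simp add: sum.reindex[OF injI])
      define co where "co i = (\<Prod>j\<in>I - {i}. (c j)\<^sup>2) * - c i * z (x i)" for i
      have "of_int (W * pr) * g = of_int pr * (of_int W * g)" by (simp add: ac_simps)
      also have "\<dots> = (\<Sum>i\<in>I. of_int (co i) * C i)"
        unfolding z sum_distrib_left
      proof (rule sum.cong[OF refl])
        fix i assume i: "i \<in> I"
        have "pr * z (x i) = co i * - c i"
          unfolding co_def pr_def prod.remove[OF I(1) i] by (simp add: power2_eq_square)
        then show "of_int pr * (of_int (z (x i)) * moment_nilpotent d (x i)) = of_int (co i) * C i"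
          unfolding C_def mult.assoc[symmetric] of_int_mult[symmetric] by simp
      qed
      finally show ?thesis by blast
    qed
    moreover have "W * pr \<ge> 1" using W(1) \<open>pr > 0\<close> by (smt (verit) mult_pos_pos)
    ultimately show ?thesis by blast
  qed
  have "char_poly (mat d d (of_int k * (boxed d (\<lambda>a b. A $$ (a, b)) + of_nat t * B i + (of_nat t)\<^sup>2 * C i)))
        = char_poly (k \<cdot>\<^sub>m A)" for k i t
  proof -
    have kA: "k \<cdot>\<^sub>m A \<in> carrier_mat d d" using Ac by simp
    note conj = transvection_conjugate[OF kA vu[of i], where t = "int t"]
    have "mat d d (of_int k * (boxed d (\<lambda>a b. A $$ (a, b)) + of_nat t * B i + (of_nat t)\<^sup>2 * C i))
        = transvection d (u i) (v i) (int t) * (k \<cdot>\<^sub>m A) * transvection d (u i) (v i) (- int t)" (is "?L = ?R")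
    proof (rule eq_matI)
      fix a b assume "a < dim_row ?R" "b < dim_col ?R"
      then have ab: "a < d" "b < d" using conj(1) by auto
      have ci: "(\<Sum>l<d. \<Sum>m<d. v i l * (k \<cdot>\<^sub>m A) $$ (l, m) * u i m) = k * c i"
        using Ac by (simp add: c_def moment_pairing_def v_def u_def sum_distrib_left ac_simps)
      have 1: "(\<Sum>l<d. v i l * (k \<cdot>\<^sub>m A) $$ (l, b)) = k * (\<Sum>l<d. v i l * A $$ (l, b))"
        using Ac ab by (simp add: sum_distrib_left ac_simps)
      have 2: "(\<Sum>l<d. (k \<cdot>\<^sub>m A) $$ (a, l) * u i l) = k * (\<Sum>l<d. A $$ (a, l) * u i l)"
        using Ac ab by (simp add: sum_distrib_left ac_simps)
      show "?L $$ (a, b) = ?R $$ (a, b)"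
        unfolding conj(3)[OF ab] ci 1 2
        using Ac ab
        by (simp add: fun_apply B_def C_def boxed_def moment_nilpotent_def u_def[symmetric] v_def[symmetric]
            power2_eq_square algebra_simps)
    qed (use conj(1) in auto)
    then show ?thesis using conj(2) by simp
  qed
  with B C span show ?thesis by blast
qed

subsection \<open>Boxes of trace zero matrices\<close>

definition mat_fun :: "nat \<Rightarrow> int mat \<Rightarrow> nat \<times> nat \<Rightarrow> int" where
  "mat_fun d M = boxed d (\<lambda>a b. M $$ (a, b))"

lemma mat_mat_fun: "M \<in> carrier_mat d d \<Longrightarrow> mat d d (mat_fun d M) = M"
  by (rule eq_matI) (auto simp: mat_fun_def boxed_def)

lemma mat_fun_mat: "g \<in> trace_zero d \<Longrightarrow> mat_fun d (mat d d g) = g"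
  by (rule ext) (auto simp: mat_fun_def boxed_def trace_zero_def)

lemma mat_fun_trace_zero: "M \<in> M0 d \<Longrightarrow> mat_fun d M \<in> trace_zero d"
  unfolding mat_fun_def M0_def by (auto intro: boxed_trace_zero)

lemma mat_M0: "g \<in> trace_zero d \<Longrightarrow> mat d d g \<in> M0 d"
  by (auto simp: M0_def trace_zero_def)

lemma inj_on_mat_fun: "inj_on (mat_fun d) (M0 d)"
  by (rule inj_onI) (metis (no_types, lifting) M0_def mat_mat_fun mem_Collect_eq)

definition fun_box :: "nat \<Rightarrow> nat \<Rightarrow> (nat \<times> nat \<Rightarrow> int) set" where
  "fun_box d n = {g \<in> trace_zero d. \<forall>i<d. \<forall>j<d. (i, j) \<noteq> (d - 1, d - 1) \<longrightarrow> \<bar>g (i, j)\<bar> \<le> int n}"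

lemma mat_fun_Fbox: "mat_fun d ` Fbox d n = fun_box d n"
proof (intro equalityI subsetI)
  fix g assume "g \<in> mat_fun d ` Fbox d n"
  then show "g \<in> fun_box d n"
    by (auto simp: Fbox_def fun_box_def mat_fun_trace_zero) (auto simp: mat_fun_def boxed_def)
next
  fix g assume g: "g \<in> fun_box d n"
  then have "mat d d g \<in> Fbox d n" by (auto simp: Fbox_def fun_box_def mat_M0)
  moreover have "g = mat_fun d (mat d d g)" using g by (simp add: fun_box_def mat_fun_mat)
  ultimately show "g \<in> mat_fun d ` Fbox d n" by blast
qed

text \<open>The entry in the last corner is determined by the trace, and the other
  \<open>d * d - 1\<close> entries are free.\<close>

lemma card_fun_box:
  assumes d: "d > 0"
  shows "finite (fun_box d n)" "card (fun_box d n) = (2 * n + 1) ^ (d * d - 1)"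
proof -
  define J where "J = ({..<d} \<times> {..<d}) - {(d - 1, d - 1)}"
  have J: "finite J" "card J = d * d - 1" using d by (auto simp: J_def card_Diff_singleton)
  let ?P = "PiE J (\<lambda>_. {- int n..int n})"
  \<comment> \<open>Restores the corner entry from the remaining diagonal.\<close>
  let ?ext = "\<lambda>h p. if p = (d - 1, d - 1) then - (\<Sum>i<d - 1. h (i, i)) else if p \<in> J then h p else (0::int)"
  have dec: "(\<Sum>i<d. f i) = (\<Sum>i<d - 1. f i) + f (d - 1)" for f :: "nat \<Rightarrow> int"
    using d by (cases d) auto
  have "bij_betw (\<lambda>g. restrict g J) (fun_box d n) ?P"
  proof (rule bij_betw_byWitness[where f' = ?ext])
    show "\<forall>g\<in>fun_box d n. ?ext (restrict g J) = g"
    proof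
      fix g assume g: "g \<in> fun_box d n"
      have corner: "g (d - 1, d - 1) = - (\<Sum>i<d - 1. g (i, i))"
        using g dec[of "\<lambda>i. g (i, i)"] by (simp add: fun_box_def trace_zero_def)
      have diag: "(\<Sum>i<d - 1. restrict g J (i, i)) = (\<Sum>i<d - 1. g (i, i))"
        by (rule sum.cong) (auto simp: J_def)
      show "?ext (restrict g J) = g"
        unfolding diag using corner g by (auto simp: fun_eq_iff fun_box_def trace_zero_def J_def)
    qed
    show "\<forall>h\<in>?P. restrict (?ext h) J = h"
    proof
      fix h assume h: "h \<in> ?P"
      show "restrict (?ext h) J = h"
      proof
        fix p
        have "(d - 1, d - 1) \<notin> J" by (simp add: J_def)
        then show "restrict (?ext h) J p = h p"
          using PiE_arb[OF h, of p] by (cases "p \<in> J") auto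
      qed
    qed
    show "(\<lambda>g. restrict g J) ` fun_box d n \<subseteq> ?P"
    proof (rule image_subsetI)
      fix g assume g: "g \<in> fun_box d n"
      have "g p \<in> {- int n..int n}" if "p \<in> J" for p
      proof -
        obtain i j where p: "p = (i, j)" by force
        have "\<bar>g (i, j)\<bar> \<le> int n" using g that unfolding p fun_box_def J_def by blast
        then show ?thesis unfolding p by (simp add: abs_le_iff minus_le_iff)
      qed
      then show "restrict g J \<in> ?P" by (simp only: restrict_PiE_iff) blast
    qed
    show "?ext ` ?P \<subseteq> fun_box d n"
    proof
      fix g assume "g \<in> ?ext ` ?P"
      then obtain h where h: "h \<in> ?P" "g = ?ext h" by blast
      have "(\<Sum>i<d - 1. g (i, i)) = (\<Sum>i<d - 1. h (i, i))"
        unfolding h(2) by (rule sum.cong) (auto simp: J_def)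
      then have "(\<Sum>i<d. g (i, i)) = 0" unfolding dec by (simp add: h(2))
      moreover have "g (i, j) = 0" if "\<not> (i < d \<and> j < d)" for i j
      proof -
        have "(i, j) \<notin> J" using that by (auto simp: J_def)
        moreover have "(i, j) \<noteq> (d - 1, d - 1)" using that d by auto
        ultimately show ?thesis unfolding h(2) by (simp only: if_False)
      qed
      moreover have "\<bar>g (i, j)\<bar> \<le> int n" if "i < d" "j < d" "(i, j) \<noteq> (d - 1, d - 1)" for i j
      proof -
        have "(i, j) \<in> J" using that by (auto simp: J_def)
        then have "g (i, j) = h (i, j)" unfolding h(2) using that(3) by (simp only: if_False if_True)
        then show ?thesis using PiE_mem[OF h(1) \<open>(i, j) \<in> J\<close>] by (simp add: abs_le_iff minus_le_iff)
      qed
      ultimately show "g \<in> fun_box d n" by (simp add: fun_box_def trace_zero_def)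
    qed
  qed
  moreover have "finite ?P" using J by (intro finite_PiE) auto
  moreover have "card ?P = (2 * n + 1) ^ (d * d - 1)"
  proof -
    have "card {- int n..int n} = 2 * n + 1" by simp
    then show ?thesis by (simp only: card_PiE[OF J(1)] prod_constant J(2))
  qed
  ultimately show "finite (fun_box d n)" "card (fun_box d n) = (2 * n + 1) ^ (d * d - 1)"
    by (auto simp: bij_betw_finite bij_betw_same_card)
qed

lemma trace_zero_add: "v \<in> trace_zero d \<Longrightarrow> w \<in> trace_zero d \<Longrightarrow> v + w \<in> trace_zero d"
  by (auto simp: trace_zero_def sum.distrib)

lemma fun_box_mono: "m \<le> n \<Longrightarrow> fun_box d m \<subseteq> fun_box d n"
  by (force simp: fun_box_def)

text \<open>A box shrunk by the size of \<open>v\<close> stays inside the original after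
  translation, and the ratio of the two cardinalities tends to 1. The unconstrained corner entry
  takes care of itself because traces add.\<close>

lemma fun_box_Folner:
  assumes d: "d > 0" and v: "v \<in> trace_zero d"
  shows "(\<lambda>n. real (card {x \<in> fun_box d (Suc n). x + v \<notin> fun_box d (Suc n)}) / real (card (fun_box d (Suc n)))) \<longlonglongrightarrow> 0"
proof -
  define N where "N = d * d - 1"
  \<comment> \<open>A crude common bound for all entries of \<open>v\<close>.\<close>
  define r where "r = (\<Sum>p\<in>{..<d} \<times> {..<d}. nat \<bar>v p\<bar>)"
  have r: "\<bar>v (i, j)\<bar> \<le> int r" if "i < d" "j < d" for i j
  proof -
    have "nat \<bar>v (i, j)\<bar> \<le> r"
      unfolding r_def by (rule member_le_sum) (use that in auto)
    then show ?thesis by linarith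
  qed
  have "real (card {x \<in> fun_box d (Suc n). x + v \<notin> fun_box d (Suc n)}) / real (card (fun_box d (Suc n)))
      \<le> 1 - (1 - 2 * real r / (2 * real n + 3)) ^ N" if n: "n \<ge> r" for n
  proof -
    have quot: "(y ^ N - z ^ N) / y ^ N = 1 - (z / y) ^ N" if "y > 0" for y z :: real
      using that by (simp add: power_divide diff_divide_distrib)
    have "x + v \<in> fun_box d (Suc n)" if x: "x \<in> fun_box d (Suc n - r)" for x
    proof -
      have "\<bar>(x + v) (i, j)\<bar> \<le> int (Suc n)" if "i < d" "j < d" "(i, j) \<noteq> (d - 1, d - 1)" for i j
      proof -
        have "\<bar>x (i, j)\<bar> \<le> int (Suc n - r)" using x that by (simp add: fun_box_def)
        then show ?thesis using r[OF that(1,2)] n by (simp add: of_nat_diff)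
      qed
      then show ?thesis using x v trace_zero_add by (simp add: fun_box_def)
    qed
    then have "{x \<in> fun_box d (Suc n). x + v \<notin> fun_box d (Suc n)} \<subseteq> fun_box d (Suc n) - fun_box d (Suc n - r)"
      by blast
    then have "card {x \<in> fun_box d (Suc n). x + v \<notin> fun_box d (Suc n)} \<le> card (fun_box d (Suc n) - fun_box d (Suc n - r))"
      by (intro card_mono) (auto simp: card_fun_box[OF d])
    also have "\<dots> = card (fun_box d (Suc n)) - card (fun_box d (Suc n - r))"
      by (intro card_Diff_subset fun_box_mono) (auto simp: card_fun_box[OF d])
    finally have "real (card {x \<in> fun_box d (Suc n). x + v \<notin> fun_box d (Suc n)})
        \<le> real (card (fun_box d (Suc n)) - card (fun_box d (Suc n - r)))" by (simp only: of_nat_le_iff)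
    also have "\<dots> = real (card (fun_box d (Suc n))) - real (card (fun_box d (Suc n - r)))"
      by (intro of_nat_diff card_mono fun_box_mono card_fun_box[OF d]) auto
    also have "real (card (fun_box d (Suc n))) = (2 * real n + 3) ^ N"
      by (simp add: card_fun_box[OF d] N_def add.commute)
    also have "real (card (fun_box d (Suc n - r))) = (2 * real n + 3 - 2 * real r) ^ N"
    proof -
      have "real (2 * (Suc n - r) + 1) = 2 * real n + 3 - 2 * real r" using n by (simp add: of_nat_diff)
      then show ?thesis by (simp only: card_fun_box(2)[OF d] of_nat_power N_def)
    qed
    finally have "real (card {x \<in> fun_box d (Suc n). x + v \<notin> fun_box d (Suc n)}) / (2 * real n + 3) ^ N
        \<le> ((2 * real n + 3) ^ N - (2 * real n + 3 - 2 * real r) ^ N) / (2 * real n + 3) ^ N"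
      by (rule divide_right_mono) simp
    also have "\<dots> = 1 - ((2 * real n + 3 - 2 * real r) / (2 * real n + 3)) ^ N"
      by (rule quot) simp
    also have "(2 * real n + 3 - 2 * real r) / (2 * real n + 3) = 1 - 2 * real r / (2 * real n + 3)"
      by (simp add: diff_divide_distrib)
    also have "(2 * real n + 3) ^ N = real (card (fun_box d (Suc n)))"
      by (simp add: card_fun_box[OF d] N_def add.commute)
    finally show ?thesis .
  qed
  then have up: "eventually (\<lambda>n. real (card {x \<in> fun_box d (Suc n). x + v \<notin> fun_box d (Suc n)}) / real (card (fun_box d (Suc n)))
      \<le> 1 - (1 - 2 * real r / (2 * real n + 3)) ^ N) sequentially"
    unfolding eventually_sequentially by blast
  have "(\<lambda>n. 2 * real r / (2 * real n + 3)) \<longlonglongrightarrow> 0" by real_asymp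
  then have "(\<lambda>n. 1 - (1 - 2 * real r / (2 * real n + 3)) ^ N) \<longlonglongrightarrow> 1 - (1 - 0) ^ N"
    by (intro tendsto_intros)
  then have "(\<lambda>n. 1 - (1 - 2 * real r / (2 * real n + 3)) ^ N) \<longlonglongrightarrow> 0" by simp
  from tendsto_sandwich[OF _ up tendsto_const this] show ?thesis by simp
qed

lemma frequently_of_upper_density:
  assumes "upper_density d E > 0"
  shows "\<exists>\<delta>>0. \<exists>\<^sub>F n in sequentially. \<delta> \<le> real (card (E \<inter> Fbox d (Suc n))) / real (card (Fbox d (Suc n)))"
proof -
  obtain \<delta> :: real where \<delta>: "0 < ereal \<delta>" "ereal \<delta> < upper_density d E"
    using ereal_dense2[OF assms] by auto
  have "\<exists>\<^sub>F n in sequentially. \<delta> \<le> real (card (E \<inter> Fbox d (Suc n))) / real (card (Fbox d (Suc n)))"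
  proof (rule ccontr)
    assume "\<not> ?thesis"
    then have "eventually (\<lambda>n. ereal (real (card (E \<inter> Fbox d (Suc n))) / real (card (Fbox d (Suc n)))) \<le> ereal \<delta>) sequentially"
      unfolding not_frequently by (rule eventually_mono) simp
    then have "upper_density d E \<le> ereal \<delta>" unfolding upper_density_def by (rule Limsup_bounded)
    with \<delta> show False by simp
  qed
  then show ?thesis using \<delta>(1) by auto
qed

theorem theorem1p1:
  fixes d :: nat and E :: "int mat set"
  assumes "d \<ge> 2" and "E \<subseteq> M0 d" and "upper_density d E > 0"
  shows "\<exists>k::int. k \<ge> 1 \<and>
           (\<forall>a :: nat \<Rightarrow> int.
              \<exists>A \<in> {x - y | x y. x \<in> E \<and> y \<in> E}.
                char_poly A = monom 1 d + (\<Sum>j\<in>{2..d}. monom (k ^ j * a (d - j)) (d - j)))"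
proof -
  have d: "d > 0" using assms(1) by simp
  obtain \<delta> where \<delta>: "\<delta> > 0" "\<exists>\<^sub>F n in sequentially. \<delta> \<le> real (card (E \<inter> Fbox d (Suc n))) / real (card (Fbox d (Suc n)))"
    using frequently_of_upper_density[OF assms(3)] by blast
  have FM: "Fbox d n \<subseteq> M0 d" for n by (auto simp: Fbox_def)
  have "card (E \<inter> Fbox d n) = card (mat_fun d ` E \<inter> fun_box d n)" for n
  proof -
    have "mat_fun d ` E \<inter> fun_box d n = mat_fun d ` (E \<inter> Fbox d n)"
      unfolding mat_fun_Fbox[symmetric] by (rule inj_on_image_Int[OF inj_on_mat_fun assms(2) FM, symmetric])
    also have "card \<dots> = card (E \<inter> Fbox d n)"
      by (rule card_image) (rule inj_on_subset[OF inj_on_mat_fun], use FM in blast)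
    finally show ?thesis by simp
  qed
  moreover have "card (Fbox d n) = card (fun_box d n)" for n
    unfolding mat_fun_Fbox[symmetric]
    by (rule card_image[symmetric]) (rule inj_on_subset[OF inj_on_mat_fun FM])
  ultimately have dens: "\<exists>\<^sub>F n in sequentially. \<delta> \<le> real (card (mat_fun d ` E \<inter> fun_box d (Suc n))) / real (card (fun_box d (Suc n)))"
    using \<delta>(2) by simp
  have "\<exists>ip. shift_form ip (\<lambda>v. Poly_Mapping.single v 1 :: (nat \<times> nat \<Rightarrow> int) \<Rightarrow>\<^sub>0 real) (trace_zero d) (\<delta>\<^sup>2) \<and>
    (\<forall>v. ip 1 (Poly_Mapping.single v 1) > 0 \<longrightarrow> (\<exists>x\<in>mat_fun d ` E. x + v \<in> mat_fun d ` E))"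
  proof (rule shift_form_of_Folner[OF _ _ _ _ _ _ \<delta>(1) dens])
    show "finite (fun_box d (Suc n))" for n by (rule card_fun_box[OF d])
    have "card (fun_box d (Suc n)) > 0" for n by (simp add: card_fun_box[OF d])
    then show "fun_box d (Suc n) \<noteq> {}" for n by (metis card.empty less_irrefl)
    show "0 \<in> trace_zero d" by (simp add: trace_zero_def)
    show "v + w \<in> trace_zero d" if "v \<in> trace_zero d" "w \<in> trace_zero d" for v w
      using that by (rule trace_zero_add)
    show "- v \<in> trace_zero d" if "v \<in> trace_zero d" for v
      using that by (simp add: trace_zero_def sum_negf)
  qed (rule fun_box_Folner[OF d])
  then obtain ip where
    form: "shift_form ip (\<lambda>v. Poly_Mapping.single v 1 :: (nat \<times> nat \<Rightarrow> int) \<Rightarrow>\<^sub>0 real) (trace_zero d) (\<delta>\<^sup>2)"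
    and hit: "\<And>v. ip 1 (Poly_Mapping.single v 1) > 0 \<Longrightarrow> \<exists>x\<in>mat_fun d ` E. x + v \<in> mat_fun d ` E"
    by blast
  from shift_form.quadratic_curves_recurrence[OF form] obtain k :: int where k: "k \<ge> 1"
    and rec: "\<And>A B C r. (\<forall>i::nat. A i \<in> trace_zero d \<and> B i \<in> trace_zero d \<and> C i \<in> trace_zero d) \<Longrightarrow>
     (\<forall>I. finite I \<longrightarrow> card I = 2 ^ r \<longrightarrow>
        (\<exists>m::int. m \<ge> 1 \<and> (\<forall>g\<in>trace_zero d. \<exists>z. of_int m * g = (\<Sum>i\<in>I. of_int (z i) * C i)))) \<Longrightarrow>
     (\<exists>i t::nat. ip 1 (Poly_Mapping.single (of_int k * (A i + of_nat t * B i + (of_nat t)\<^sup>2 * C i)) 1) > 0)"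
    by blast
  have "\<exists>A \<in> {x - y | x y. x \<in> E \<and> y \<in> E}.
      char_poly A = monom 1 d + (\<Sum>j\<in>{2..d}. monom (k ^ j * a (d - j)) (d - j))" for a :: "nat \<Rightarrow> int"
  proof -
    \<comment> \<open>The sum in the goal starts at \<open>j = 2\<close> and never reads
      \<open>a (d - 1)\<close>; setting it to 0 makes the companion matrix trace free.\<close>
    define a' where "a' = a(d - 1 := 0)"
    \<comment> \<open>Subdiagonal 1 gives the nonzero entry at \<open>(1, 0)\<close>; multiplication
      by \<open>k\<close> later yields the companion matrix with subdiagonal \<open>k\<close> and
      the weights \<open>k ^ j\<close>.\<close>
    define A where "A = companion_matrix d 1 (\<lambda>i. - a' i)"
    have A: "A \<in> M0 d" "A $$ (1, 0) \<noteq> 0"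
      using assms(1) by (auto simp: A_def companion_matrix_def M0_def a'_def intro!: sum.neutral)
    from quadratic_conjugates[OF assms(1) A, folded mat_fun_def]
    obtain B C r where BC: "\<forall>i::nat. B i \<in> trace_zero d \<and> C i \<in> trace_zero d"
      and span: "\<forall>I. finite I \<longrightarrow> card I = 2 ^ r \<longrightarrow>
        (\<exists>m::int. m \<ge> 1 \<and> (\<forall>g\<in>trace_zero d. \<exists>z. of_int m * g = (\<Sum>i\<in>I. of_int (z i) * C i)))"
      and cp: "\<forall>k i t. char_poly (mat d d (of_int k * (mat_fun d A + of_nat t * B i + (of_nat t)\<^sup>2 * C i))) = char_poly (k \<cdot>\<^sub>m A)"
      by (elim exE conjE) (rule that)
    obtain i t where "ip 1 (Poly_Mapping.single (of_int k * (mat_fun d A + of_nat t * B i + (of_nat t)\<^sup>2 * C i)) 1) > 0"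
      using rec[of "\<lambda>_. mat_fun d A" B C, OF _ span] BC mat_fun_trace_zero[OF A(1)] by auto
    from hit[OF this] obtain X Y where XY: "X \<in> E" "Y \<in> E"
      "mat_fun d X + of_int k * (mat_fun d A + of_nat t * B i + (of_nat t)\<^sup>2 * C i) = mat_fun d Y"
      by blast
    have c: "X \<in> carrier_mat d d" "Y \<in> carrier_mat d d" using XY assms(2) by (auto simp: M0_def)
    have "of_int k * (mat_fun d A + of_nat t * B i + (of_nat t)\<^sup>2 * C i) = mat_fun d Y - mat_fun d X"
      using XY(3) by (simp only: eq_diff_eq add.commute)
    moreover have "mat d d (mat_fun d Y - mat_fun d X) = Y - X"
      by (rule eq_matI) (use c in \<open>auto simp: mat_fun_def boxed_def\<close>)
    ultimately have "char_poly (Y - X) = char_poly (k \<cdot>\<^sub>m A)" 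
      using cp[rule_format, of k t i] by (simp only:)
    also have "k \<cdot>\<^sub>m A = companion_matrix d k (\<lambda>i. - k * a' i)"
      by (rule eq_matI) (auto simp: A_def companion_matrix_def)
    also have "char_poly \<dots> = monom 1 d + (\<Sum>j\<in>{2..d}. monom (k ^ j * a' (d - j)) (d - j))"
      by (rule char_poly_trace_zero_companion[OF assms(1)]) (simp add: a'_def)
    also have "\<dots> = monom 1 d + (\<Sum>j\<in>{2..d}. monom (k ^ j * a (d - j)) (d - j))"
      by (intro arg_cong2[of _ _ _ _ "(+)"] sum.cong refl) (auto simp: a'_def)
    finally show ?thesis using XY by blast
  qed
  with k show ?thesis by blast
qed

end
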